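(* Let $\Sigma$ be a complete simplicial fan in $N_{\mathbb R}$, $\dim N_{\mathbb R}=d$, such that $-D_\rho|_{D_\rho}=0$ for all rays $\rho\in\Sigma(1)$. Then $\Sigma$ is the fan of a cross polytope: its rays form $d$ antipodal pairs $\pm\rho_1,\dots,\pm\rho_d$ with $\rho_1,\dots,\rho_d$ linearly independent, and its maximal cones are exactly those generated by choosing one ray from each pair. (Conversely, for the fan of the $d$-fold product $\mathbb P^1\times\dots\times\mathbb P^1$, which gives the cross polytope, $-D_\rho|_{D_\rho}=0$ for all rays $\rho$.)
   Context: $D_\rho$ is the torus-invariant prime divisor on $X_\Sigma$ corresponding to the ray $\rho$; divisor classes and their restrictions are taken with rational coefficients, and $-D_\rho|_{D_\rho}=0$ is equivalent to the union of the cones $\tau\in\Sigma$ with $\tau\cap\rho=\{0\}$, $\tau+\rho\in\Sigma$ being a codimension one vector subspace of $N_{\mathbb R}$. *)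

theory Defs
  imports "HOL-Analysis.Analysis"
begin

section \<open>Lattices\<close>

text \<open>
  A lattice \<open>N\<close> is the set of integral combinations of a finite linearly independent set in an
  ambient Euclidean space; the real vector space \<open>N\<^sub>\<real>\<close> is \<open>span N\<close>, which may be a proper subspace
  of the ambient space, so every rank \<open>dim N \<ge> 0\<close> occurs.
\<close>

definition lattice_basis :: "'a::euclidean_space set \<Rightarrow> 'a set \<Rightarrow> bool" where
  "lattice_basis N B \<longleftrightarrow> finite B \<and> independent B \<and>
     N = {\<Sum>b\<in>B. of_int (k b) *\<^sub>R b | k :: 'a \<Rightarrow> int. True}"

definition is_lattice :: "'a::euclidean_space set \<Rightarrow> bool" where
  "is_lattice N \<longleftrightarrow> (\<exists>B. lattice_basis N B)"

text \<open>
  The dual space \<open>M\<^sub>\<rat>\<close>: linear functionals that are rational on \<open>N\<close>. Their values outside \<open>span N\<close>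
  are never used.
\<close>

definition MQ :: "'a::euclidean_space set \<Rightarrow> ('a \<Rightarrow> real) set" where
  "MQ N = {m. linear m \<and> (\<forall>x\<in>N. m x \<in> \<rat>)}"

section \<open>Fans\<close>

definition rational_cone :: "'a::euclidean_space set \<Rightarrow> 'a set \<Rightarrow> bool" where
  "rational_cone N \<sigma> \<longleftrightarrow> (\<exists>S. finite S \<and> S \<subseteq> N \<and> \<sigma> = convex_cone hull S)"

definition strongly_convex :: "'a::euclidean_space set \<Rightarrow> bool" where
  "strongly_convex \<sigma> \<longleftrightarrow> \<sigma> \<inter> uminus ` \<sigma> = {0}"

text \<open>
  The empty set is a face in the sense of \<open>face_of\<close>; the faces of a polyhedral cone in the sense of
  toric geometry are its nonempty faces.
\<close>

definition is_fan :: "'a::euclidean_space set \<Rightarrow> 'a set set \<Rightarrow> bool" where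
  "is_fan N \<Sigma> \<longleftrightarrow> finite \<Sigma> \<and> \<Sigma> \<noteq> {} \<and>
     (\<forall>\<sigma>\<in>\<Sigma>. rational_cone N \<sigma> \<and> strongly_convex \<sigma>) \<and>
     (\<forall>\<sigma>\<in>\<Sigma>. \<forall>\<tau>. \<tau> face_of \<sigma> \<and> \<tau> \<noteq> {} \<longrightarrow> \<tau> \<in> \<Sigma>) \<and>
     (\<forall>\<sigma>\<in>\<Sigma>. \<forall>\<tau>\<in>\<Sigma>. (\<sigma> \<inter> \<tau>) face_of \<sigma> \<and> (\<sigma> \<inter> \<tau>) face_of \<tau>)"

definition complete_fan :: "'a::euclidean_space set \<Rightarrow> 'a set set \<Rightarrow> bool" where
  "complete_fan N \<Sigma> \<longleftrightarrow> is_fan N \<Sigma> \<and> \<Union>\<Sigma> = span N"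

definition simplicial_fan :: "'a::euclidean_space set \<Rightarrow> 'a set set \<Rightarrow> bool" where
  "simplicial_fan N \<Sigma> \<longleftrightarrow> is_fan N \<Sigma> \<and>
     (\<forall>\<sigma>\<in>\<Sigma>. \<exists>S. finite S \<and> independent S \<and> \<sigma> = convex_cone hull S)"

definition rays :: "'a::euclidean_space set set \<Rightarrow> 'a set set" where
  "rays \<Sigma> = {\<rho>\<in>\<Sigma>. dim \<rho> = 1}"

definition maximal_cones :: "'a set set \<Rightarrow> 'a set set" where
  "maximal_cones \<Sigma> = {\<sigma>\<in>\<Sigma>. \<forall>\<tau>\<in>\<Sigma>. \<sigma> \<subseteq> \<tau> \<longrightarrow> \<tau> = \<sigma>}"

section \<open>Torus-invariant divisors and their restrictions\<close>

text \<open>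
  Divisor theory on the toric variety \<open>X\<close> of a fan \<open>\<Sigma>\<close>, in terms of the fan (see Fulton,
  Introduction to Toric Varieties, Sections 3.1, 3.3, 3.4 and 5.1). The orbit closure \<open>V(\<tau>)\<close> of a
  cone \<open>\<tau> \<in> \<Sigma>\<close> is the toric variety with character space the annihilator of \<open>\<tau>\<close> in \<open>M\<^sub>\<rat>\<close>; its
  torus-invariant prime divisors are the \<open>V(\<sigma>)\<close> with \<open>\<tau>\<close> a facet of \<open>\<sigma>\<close>. Thus \<open>V({0}) = X\<close> and
  \<open>V(\<rho>) = D\<^sub>\<rho>\<close> for a ray \<open>\<rho>\<close>. A torus-invariant \<open>\<rat>\<close>-divisor on \<open>V(\<tau>)\<close> is represented by its
  coefficient function on these cones \<open>\<sigma>\<close>.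
\<close>

definition prime_divisors :: "'a::euclidean_space set set \<Rightarrow> 'a set \<Rightarrow> 'a set set" where
  "prime_divisors \<Sigma> \<tau> = {\<sigma>\<in>\<Sigma>. \<tau> face_of \<sigma> \<and> dim \<sigma> = dim \<tau> + 1}"

text \<open>
  For a facet \<open>\<tau>\<close> of \<open>\<sigma>\<close>, a lattice point of \<open>\<sigma>\<close> whose class generates the infinite cyclic group
  \<open>N\<^sub>\<sigma> / N\<^sub>\<tau>\<close>, where \<open>N\<^sub>\<sigma> = N \<inter> span \<sigma>\<close>. It is unique modulo \<open>N\<^sub>\<tau>\<close>. For \<open>\<tau> = {0}\<close> it is the
  primitive generator of the ray \<open>\<sigma>\<close>.
\<close>

definition normal_gen :: "'a::euclidean_space set \<Rightarrow> 'a set \<Rightarrow> 'a set \<Rightarrow> 'a" where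
  "normal_gen N \<tau> \<sigma> = (SOME v. v \<in> N \<inter> \<sigma> \<and>
     N \<inter> span \<sigma> = {x + of_int k *\<^sub>R v | x k. x \<in> N \<inter> span \<tau>})"

definition primitive_gen :: "'a::euclidean_space set \<Rightarrow> 'a set \<Rightarrow> 'a" where
  "primitive_gen N \<rho> = normal_gen N {0} \<rho>"

text \<open>
  The character \<open>m\<close> of the torus of \<open>V(\<tau>)\<close> vanishes along \<open>V(\<sigma>)\<close> to order
  \<open>m (normal_gen N \<tau> \<sigma>)\<close>. Two \<open>\<rat>\<close>-divisors on \<open>V(\<tau>)\<close> have the same class with rational
  coefficients iff they differ by the divisor of an \<open>m \<in> M\<^sub>\<rat>\<close> that annihilates \<open>\<tau>\<close>.
\<close>

definition lin_equiv ::
  "'a::euclidean_space set \<Rightarrow> 'a set set \<Rightarrow> 'a set \<Rightarrow> ('a set \<Rightarrow> real) \<Rightarrow> ('a set \<Rightarrow> real) \<Rightarrow> bool" where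
  "lin_equiv N \<Sigma> \<tau> E E' \<longleftrightarrow> (\<exists>m\<in>MQ N. (\<forall>x\<in>\<tau>. m x = 0) \<and>
     (\<forall>\<sigma>\<in>prime_divisors \<Sigma> \<tau>. E \<sigma> - E' \<sigma> = m (normal_gen N \<tau> \<sigma>)))"

text \<open>
  \<open>\<rat>\<close>-Cartier data of a divisor \<open>D = \<Sum>\<^sub>\<rho> a\<^sub>\<rho> D\<^sub>\<rho>\<close> on \<open>X\<close>: on the affine chart of \<open>\<sigma>\<close> the divisor \<open>D\<close>
  is that of the rational character \<open>-m\<^sub>\<sigma>\<close>. Such data exist for every \<open>D\<close> if \<open>\<Sigma>\<close> is simplicial,
  and \<open>m\<^sub>\<sigma>\<close> is unique up to the annihilator of \<open>\<sigma>\<close>.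
\<close>

definition cartier_data ::
  "'a::euclidean_space set \<Rightarrow> 'a set set \<Rightarrow> ('a set \<Rightarrow> real) \<Rightarrow> ('a set \<Rightarrow> 'a \<Rightarrow> real) \<Rightarrow> bool" where
  "cartier_data N \<Sigma> a m \<longleftrightarrow> (\<forall>\<sigma>\<in>\<Sigma>. m \<sigma> \<in> MQ N \<and>
     (\<forall>\<rho>\<in>rays \<Sigma>. \<rho> \<subseteq> \<sigma> \<longrightarrow> m \<sigma> (primitive_gen N \<rho>) = - a \<rho>))"

text \<open>
  Adding to \<open>D\<close> the divisor of the character \<open>m\<^sub>\<tau>\<close> gives a divisor in the same class whose support
  does not contain \<open>V(\<tau>)\<close> and whose Cartier data are \<open>m\<^sub>\<sigma> - m\<^sub>\<tau>\<close>. The following is its restriction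
  to \<open>V(\<tau>)\<close>; the class does not depend on the choice of the data.
\<close>

definition restrict_divisor ::
  "'a::euclidean_space set \<Rightarrow> 'a set \<Rightarrow> ('a set \<Rightarrow> 'a \<Rightarrow> real) \<Rightarrow> 'a set \<Rightarrow> real" where
  "restrict_divisor N \<tau> m \<sigma> = - (m \<sigma> (normal_gen N \<tau> \<sigma>) - m \<tau> (normal_gen N \<tau> \<sigma>))"

definition restricts_to_zero ::
  "'a::euclidean_space set \<Rightarrow> 'a set set \<Rightarrow> ('a set \<Rightarrow> real) \<Rightarrow> 'a set \<Rightarrow> bool" where
  "restricts_to_zero N \<Sigma> a \<tau> \<longleftrightarrow>
     (\<exists>m. cartier_data N \<Sigma> a m \<and> lin_equiv N \<Sigma> \<tau> (restrict_divisor N \<tau> m) (\<lambda>_. 0))"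

definition ray_divisor :: "'a set \<Rightarrow> 'a set \<Rightarrow> real" where
  "ray_divisor \<rho> = (\<lambda>\<rho>'. if \<rho>' = \<rho> then 1 else 0)"

section \<open>Cross polytopes and products of projective lines\<close>

definition cross_polytope_fan :: "nat \<Rightarrow> 'a::euclidean_space set set \<Rightarrow> bool" where
  "cross_polytope_fan d \<Sigma> \<longleftrightarrow> (\<exists>v :: nat \<Rightarrow> 'a.
     inj_on v {..<d} \<and> independent (v ` {..<d}) \<and>
     rays \<Sigma> = {convex_cone hull {v i} | i. i < d} \<union> {convex_cone hull {- v i} | i. i < d} \<and>
     maximal_cones \<Sigma> =
       {convex_cone hull {s i *\<^sub>R v i | i. i < d} | s :: nat \<Rightarrow> real. \<forall>i<d. s i \<in> {1, -1}})"

definition P1_fan :: "real set set" where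
  "P1_fan = {{0}, {0..}, {..0}}"

text \<open>
  The product fan of copies of the fan of the projective line, one for each element of a basis \<open>B\<close>
  of the lattice, \<open>N = (\<Oplus>\<^sub>b\<^sub>\<in>\<^sub>B \<int> b)\<close>.
\<close>

definition P1_power_fan :: "'a::euclidean_space set \<Rightarrow> 'a set set" where
  "P1_power_fan B = {{x \<in> span B. \<forall>b\<in>B. representation B x b \<in> c b} | c. \<forall>b\<in>B. c b \<in> P1_fan}"

end

theory Submission
  imports Defs
begin

text \<open>
  If \<open>-D\<^sub>\<rho>\<close> restricts to zero on \<open>D\<^sub>\<rho>\<close>, the local equations of \<open>D\<^sub>\<rho>\<close> around \<open>\<rho>\<close>, corrected by a
  character, agree with one functional \<open>h\<^sub>\<rho>\<close> which is 1 on the primitive generator of \<open>\<rho>\<close> and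
  vanishes on all adjacent rays. Completeness makes the star of \<open>\<rho>\<close> the half-space \<open>h\<^sub>\<rho> \<ge> 0\<close>, so every
  nonadjacent ray lies in \<open>h\<^sub>\<rho> < 0\<close>. For nonadjacent rays the open half-spaces are disjoint, hence
  their functionals are negative multiples of each other. Applied to the generators of the
  cone around \<open>-\<rho>\<close> this shows that \<open>-\<rho>\<close> is itself a ray, and that it is the only ray not adjacent
  to \<open>\<rho>\<close>. A basis chosen among the rays then contains one ray of each antipodal pair, and the cone
  containing a given signed sum of the basis must be the corresponding orthant.
\<close>

section \<open>Simplicial cones and their faces\<close>

text \<open>Flatness gives the values of \<open>h u\<close> on \<open>u\<close> and on its
  neighbours only. Its sign on the remaining rays is unknown at the outset and has to be extracted
  from completeness, which is why the inclusion of a half-space in a star is proved by a limiting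
  argument before any antipode is available. The argument is phrased for a family \<open>K\<close>
  of independent sets of generators, with one functional per generator: on every cone that has
  \<open>u\<close> among its generators, the global functional \<open>h u\<close> is just the
  coordinate at \<open>u\<close>, so statements about cones become statements about coordinates.
  Generators carry no normalisation there, and antipodes therefore appear as
  \<open>- c *\<^sub>R u\<close> with \<open>c > 0\<close>.\<close>

lemma convex_cone_hull_sum:
  assumes "\<And>i. i \<in> I \<Longrightarrow> f i \<in> convex_cone hull S"
  shows "sum f I \<in> convex_cone hull S"
  using assms
  by (induction I rule: infinite_finite_induct)
     (auto simp: convex_cone_hull_contains_0 convex_cone_hull_add)

lemma convex_cone_hull_subset_span: "convex_cone hull S \<subseteq> span S"
  by (rule hull_minimal) (auto simp: span_base convex_cone_span)

lemma span_convex_cone_hull: "span (convex_cone hull S) = span S"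
  by (intro antisym span_minimal[OF convex_cone_hull_subset_span subspace_span]
      span_mono[OF hull_subset])

lemma dim_convex_cone_hull:
  assumes "independent S" shows "dim (convex_cone hull S) = card S"
  by (metis assms dim_span dim_eq_card_independent span_convex_cone_hull)

lemma independent_image_scale:
  fixes S :: "'a::euclidean_space set"
  assumes "independent S" and "\<And>x. x \<in> S \<Longrightarrow> c x \<noteq> 0"
  shows "independent ((\<lambda>x. c x *\<^sub>R x) ` S)"
proof -
  have fin: "finite S" using assms(1) by (rule finiteI_independent)
  have span: "span ((\<lambda>x. c x *\<^sub>R x) ` S) = span S"
    by (rule span_image_scale) (use fin assms in auto)
  show ?thesis
  proof (rule card_le_dim_spanning[where V="span S"])
    show "(\<lambda>x. c x *\<^sub>R x) ` S \<subseteq> span S" by (auto intro: span_scale span_base)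
    show "span S \<subseteq> span ((\<lambda>x. c x *\<^sub>R x) ` S)" using span by simp
    show "finite ((\<lambda>x. c x *\<^sub>R x) ` S)" using fin by simp
    show "card ((\<lambda>x. c x *\<^sub>R x) ` S) \<le> dim (span S)"
      using card_image_le[OF fin] dim_span_eq_card_independent[OF assms(1)] by simp
  qed
qed

text \<open>Applied with a negative factor, this keeps antipodal pairs out of a basis and out of the
  generators of a cone.\<close>

lemma independent_scaleR_imp_eq:
  fixes S :: "'a::euclidean_space set"
  assumes "independent S" "a \<in> S" "b \<in> S" "a = c *\<^sub>R b"
  shows "a = b"
proof (rule ccontr)
  assume "a \<noteq> b"
  then have "a \<in> span (S - {a})"
    unfolding assms(4) using assms(3) by (intro span_scale span_base) (auto simp flip: assms(4))
  then show False using assms(1,2) unfolding dependent_def by blast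
qed

text \<open>In coordinates the cone is a nonnegative orthant, so faces, intersections and rescalings
  reduce to sign conditions. The clause \<open>x \<in> span S\<close> matters because
  \<open>representation S x\<close> is zero off the span.\<close>

lemma convex_cone_hull_independent:
  fixes S :: "'a::euclidean_space set"
  assumes S: "independent S"
  shows "convex_cone hull S = {x \<in> span S. \<forall>b\<in>S. 0 \<le> representation S x b}"
proof
  show "convex_cone hull S \<subseteq> {x \<in> span S. \<forall>b\<in>S. 0 \<le> representation S x b}"
  proof (rule hull_minimal)
    show "S \<subseteq> {x \<in> span S. \<forall>b\<in>S. 0 \<le> representation S x b}"
      using S by (auto simp: span_base representation_basis)
    show "convex_cone {x \<in> span S. \<forall>b\<in>S. 0 \<le> representation S x b}"
      unfolding convex_cone_iff using S
      by (auto simp: span_zero representation_zero span_add span_scale representation_add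
          representation_scale)
  qed
  show "{x \<in> span S. \<forall>b\<in>S. 0 \<le> representation S x b} \<subseteq> convex_cone hull S"
  proof safe
    fix x assume x: "x \<in> span S" "\<forall>b\<in>S. 0 \<le> representation S x b"
    have "(\<Sum>b\<in>S. representation S x b *\<^sub>R b) = x"
      by (rule sum_representation_eq) (use S x finiteI_independent in auto)
    moreover have "(\<Sum>b\<in>S. representation S x b *\<^sub>R b) \<in> convex_cone hull S"
      by (intro convex_cone_hull_sum convex_cone_hull_mul) (use x in \<open>auto simp: hull_inc\<close>)
    ultimately show "x \<in> convex_cone hull S" by simp
  qed
qed

lemma span_subset_iff_representation:
  fixes S :: "'a::euclidean_space set"
  assumes S: "independent S" and "T \<subseteq> S" and x: "x \<in> span S"
  shows "x \<in> span T \<longleftrightarrow> (\<forall>b\<in>S - T. representation S x b = 0)"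
proof
  assume "x \<in> span T"
  then have "representation S x = representation T x"
    using assms by (intro representation_extend) auto
  then show "\<forall>b\<in>S - T. representation S x b = 0"
    using representation_ne_zero by fastforce
next
  assume z: "\<forall>b\<in>S - T. representation S x b = 0"
  have fin: "finite S" using S by (rule finiteI_independent)
  have "x = (\<Sum>b\<in>S. representation S x b *\<^sub>R b)"
    using sum_representation_eq[OF S x fin] by simp
  also have "\<dots> = (\<Sum>b\<in>T. representation S x b *\<^sub>R b)"
    by (rule sum.mono_neutral_right) (use z fin \<open>T \<subseteq> S\<close> in auto)
  also have "\<dots> \<in> span T"
    by (intro span_sum span_scale span_base)
  finally show "x \<in> span T" .
qed

lemma convex_cone_hull_subset_iff_representation:
  fixes S :: "'a::euclidean_space set"
  assumes S: "independent S" and TS: "T \<subseteq> S"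
  shows "x \<in> convex_cone hull T \<longleftrightarrow>
    x \<in> convex_cone hull S \<and> (\<forall>b\<in>S - T. representation S x b = 0)"
proof -
  have T: "independent T" using S TS by (rule independent_mono)
  have eq: "representation S x = representation T x" if "x \<in> span T"
    using that assms by (intro representation_extend) auto
  show ?thesis
  proof
    assume x: "x \<in> convex_cone hull T"
    then have "x \<in> span T" "x \<in> convex_cone hull S"
      using convex_cone_hull_subset_span hull_mono[OF TS] by blast+
    moreover from this have "x \<in> span S"
      using convex_cone_hull_subset_span by blast
    ultimately show "x \<in> convex_cone hull S \<and> (\<forall>b\<in>S - T. representation S x b = 0)"
      using span_subset_iff_representation[OF S TS] by blast
  next
    assume x: "x \<in> convex_cone hull S \<and> (\<forall>b\<in>S - T. representation S x b = 0)"
    then have "x \<in> span S" using convex_cone_hull_subset_span by blast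
    then have "x \<in> span T"
      using x span_subset_iff_representation[OF S TS] by blast
    then show "x \<in> convex_cone hull T"
      using x eq TS by (auto simp: convex_cone_hull_independent S T)
  qed
qed

text \<open>At an interior point of a segment, the coordinate at \<open>b \<in> S - T\<close> is a
  combination of two nonnegative numbers with positive weights; its vanishing forces both to
  vanish.\<close>

lemma convex_cone_hull_face_of:
  fixes S :: "'a::euclidean_space set"
  assumes S: "independent S" and TS: "T \<subseteq> S"
  shows "(convex_cone hull T) face_of (convex_cone hull S)"
  unfolding face_of_def
proof (intro conjI ballI impI)
  show "convex_cone hull T \<subseteq> convex_cone hull S" using TS by (rule hull_mono)
  show "convex (convex_cone hull T)" by (rule convex_convex_cone_hull)
  fix x y z
  assume x: "x \<in> convex_cone hull S" and y: "y \<in> convex_cone hull S"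
    and z: "z \<in> convex_cone hull T" and "z \<in> open_segment x y"
  then obtain u where u: "0 < u" "u < 1" and zu: "z = (1 - u) *\<^sub>R x + u *\<^sub>R y"
    by (auto simp: in_segment)
  have sp: "x \<in> span S" "y \<in> span S"
    using x y convex_cone_hull_subset_span by blast+
  have "representation S x b = 0 \<and> representation S y b = 0" if b: "b \<in> S - T" for b
  proof -
    have "representation S z b = (1 - u) * representation S x b + u * representation S y b"
      by (simp add: zu S sp representation_add representation_scale span_scale)
    moreover have "representation S z b = 0"
      using z b convex_cone_hull_subset_iff_representation[OF S TS] by blast
    moreover have "0 \<le> representation S x b" "0 \<le> representation S y b"
      using x y b by (auto simp: convex_cone_hull_independent[OF S])
    ultimately show ?thesis
      using u by (smt (verit, best) mult_nonneg_nonneg mult_eq_0_iff)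
  qed
  then show "x \<in> convex_cone hull T" "y \<in> convex_cone hull T"
    using x y convex_cone_hull_subset_iff_representation[OF S TS] by auto
qed

text \<open>A face in the sense of \<open>face_of\<close> is only required to be convex. Conicity
  comes from a segment from \<open>0\<close> to a large multiple of \<open>x\<close>, which has
  \<open>x\<close> in its interior.\<close>

lemma face_of_convex_cone_conic:
  assumes F: "F face_of C" and C: "convex_cone C" and x: "x \<in> F" and c: "0 \<le> c"
  shows "c *\<^sub>R x \<in> F"
proof (cases "x = 0")
  case False
  have FC: "F \<subseteq> C" and conv: "convex F" using F by (auto simp: face_of_def)
  \<comment> \<open>\<open>k > 1\<close> puts \<open>x\<close> strictly between \<open>0\<close> and
    \<open>k *\<^sub>R x\<close>; \<open>k > c\<close> puts the desired multiple on that
    segment.\<close>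
  define k where "k = max c 1 + 1"
  have k: "k > 1" "k > c" by (auto simp: k_def)
  have "x \<in> open_segment 0 (k *\<^sub>R x)"
    unfolding in_segment using k False by (auto intro!: exI[of _ "1 / k"])
  moreover have "0 \<in> C" "k *\<^sub>R x \<in> C"
    using C FC x k by (auto intro: convex_cone_contains_0 convex_cone_scaleR)
  ultimately have in_F: "0 \<in> F" "k *\<^sub>R x \<in> F"
    using face_ofD[OF F _ _ _ x] by blast+
  have "(1 - c / k) *\<^sub>R 0 + (c / k) *\<^sub>R (k *\<^sub>R x) \<in> F"
    by (rule convexD[OF conv in_F]) (use k c in auto)
  then show ?thesis using k by simp
qed (use x in simp)

text \<open>With \<open>r\<close> the coordinate at \<open>b\<close> and
  \<open>y = x - r *\<^sub>R b\<close>, which is still in the cone, \<open>x\<close> is the midpoint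
  of \<open>(2 * r) *\<^sub>R b\<close> and \<open>2 *\<^sub>R y\<close>. Hence the face contains
  the first endpoint and, being conic, \<open>b\<close>.\<close>

lemma face_of_convex_cone_hull_support:
  fixes S :: "'a::euclidean_space set"
  assumes S: "independent S" and F: "F face_of convex_cone hull S" and x: "x \<in> F"
    and b: "representation S x b \<noteq> 0"
  shows "b \<in> F"
proof -
  have xS: "x \<in> convex_cone hull S" using F x by (auto simp: face_of_def)
  have bS: "b \<in> S" using b by (rule representation_ne_zero)
  define r where "r = representation S x b"
  have r: "r > 0" using b xS bS by (auto simp: r_def convex_cone_hull_independent[OF S] less_le)
  define y where "y = x - r *\<^sub>R b"
  have xsp: "x \<in> span S" and bsp: "b \<in> span S"
    using xS convex_cone_hull_subset_span bS by (auto simp: span_base)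
  have y: "y \<in> convex_cone hull S"
    using xS bS S unfolding convex_cone_hull_independent[OF S] y_def
    by (auto simp: span_diff span_scale xsp bsp representation_diff representation_scale
        representation_basis r_def)
  have rb: "(2 * r) *\<^sub>R b \<in> F"
  proof (cases "(2 * r) *\<^sub>R b = 2 *\<^sub>R y")
    \<comment> \<open>Coinciding endpoints have an empty open segment; \<open>x\<close> is then
      itself the multiple \<open>(2 * r) *\<^sub>R b\<close>.\<close>
    case True
    then have "2 *\<^sub>R (r *\<^sub>R b) = 2 *\<^sub>R y" by simp
    then have "r *\<^sub>R b = y" by (simp only: scaleR_cancel_left) simp
    then have "x = (2 * r) *\<^sub>R b" by (simp add: y_def scaleR_2 eq_diff_eq flip: scaleR_scaleR)
    then show ?thesis using x by simp
  next
    case False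
    have "x = (1 - 1/2) *\<^sub>R ((2 * r) *\<^sub>R b) + (1/2) *\<^sub>R (2 *\<^sub>R y)"
      by (simp add: y_def)
    then have "x \<in> open_segment ((2 * r) *\<^sub>R b) (2 *\<^sub>R y)"
      unfolding in_segment using False by (intro conjI exI[of _ "1/2::real"]) auto
    moreover have "(2 * r) *\<^sub>R b \<in> convex_cone hull S" "2 *\<^sub>R y \<in> convex_cone hull S"
      using r y bS by (simp_all add: convex_cone_hull_mul hull_inc)
    ultimately show ?thesis
      using face_ofD[OF F _ _ _ x] by blast
  qed
  have "(1 / (2 * r)) *\<^sub>R ((2 * r) *\<^sub>R b) \<in> F"
    by (rule face_of_convex_cone_conic[OF F convex_cone_convex_cone_hull rb]) (use r in simp)
  then show ?thesis using r by simp
qed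

lemma face_of_convex_cone_hull_eq:
  fixes S :: "'a::euclidean_space set"
  assumes S: "independent S" and F: "F face_of convex_cone hull S" and "F \<noteq> {}"
  shows "F = convex_cone hull (S \<inter> F)"
proof
  have FS: "F \<subseteq> convex_cone hull S" and conv: "convex F" using F by (auto simp: face_of_def)
  show "F \<subseteq> convex_cone hull (S \<inter> F)"
  proof
    fix x assume x: "x \<in> F"
    then have "\<forall>b\<in>S - (S \<inter> F). representation S x b = 0"
      using face_of_convex_cone_hull_support[OF S F] by blast
    then show "x \<in> convex_cone hull (S \<inter> F)"
      using convex_cone_hull_subset_iff_representation[OF S, of "S \<inter> F" x] x FS by blast
  qed
  have "conic F"
    using face_of_convex_cone_conic[OF F convex_cone_convex_cone_hull] by (auto simp: conic_def)
  then show "convex_cone hull (S \<inter> F) \<subseteq> F"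
    by (intro hull_minimal) (use \<open>F \<noteq> {}\<close> conv in \<open>auto simp: convex_cone_def\<close>)
qed

lemma representation_image_scale:
  fixes S :: "'a::euclidean_space set"
  assumes S: "independent S" and c: "\<And>x. x \<in> S \<Longrightarrow> c x \<noteq> 0" and x: "x \<in> span S" and b: "b \<in> S"
  shows "representation S x b = c b * representation ((\<lambda>b. c b *\<^sub>R b) ` S) x (c b *\<^sub>R b)"
proof -
  let ?f = "\<lambda>b. c b *\<^sub>R b"
  let ?T = "?f ` S"
  have T: "independent ?T" by (rule independent_image_scale) (use S c in auto)
  have fin: "finite S" using S by (rule finiteI_independent)
  have sp: "span ?T = span S" by (rule span_image_scale) (use fin c in auto)
  \<comment> \<open>Two different vectors could a priori be scaled to the same one; the dimension
    count rules this out.\<close>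
  have inj: "inj_on ?f S"
  proof (rule eq_card_imp_inj_on[OF fin])
    show "card ?T = card S"
      using T S sp by (metis dim_span_eq_card_independent)
  qed
  have "x = (\<Sum>t\<in>?T. representation ?T x t *\<^sub>R t)"
    by (rule sum_representation_eq[symmetric]) (use T x sp fin in auto)
  also have "\<dots> = (\<Sum>a\<in>S. (representation ?T x (?f a) * c a) *\<^sub>R a)"
    by (subst sum.reindex[OF inj]) simp
  finally have eq: "x = (\<Sum>a\<in>S. (representation ?T x (?f a) * c a) *\<^sub>R a)" .
  have "representation S x b
      = (\<Sum>a\<in>S. representation S ((representation ?T x (?f a) * c a) *\<^sub>R a) b)"
    by (subst eq, subst representation_sum[OF S]) (auto simp: span_base span_scale)
  also have "\<dots> = (\<Sum>a\<in>S. if a = b then representation ?T x (?f a) * c a else 0)"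
    by (rule sum.cong) (auto simp: S span_base representation_scale representation_basis)
  also have "\<dots> = representation ?T x (?f b) * c b"
    using b fin by simp
  finally show ?thesis by simp
qed

text \<open>Scaling the basis divides each coordinate by \<open>c b\<close>, so the new coordinate
  has the sign of \<open>c b * representation S x b\<close>. Positive factors leave the cone
  unchanged; the factors 1 and -1 give all orthants of one fixed basis.\<close>

lemma convex_cone_hull_image_scale:
  fixes S :: "'a::euclidean_space set"
  assumes S: "independent S" and c: "\<And>x. x \<in> S \<Longrightarrow> c x \<noteq> 0"
  shows "convex_cone hull ((\<lambda>b. c b *\<^sub>R b) ` S)
    = {x \<in> span S. \<forall>b\<in>S. 0 \<le> c b * representation S x b}"
proof -
  let ?T = "(\<lambda>b. c b *\<^sub>R b) ` S"
  have T: "independent ?T" by (rule independent_image_scale) (use S c in auto)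
  have sp: "span ?T = span S"
    by (rule span_image_scale) (use finiteI_independent[OF S] c in auto)
  have "0 \<le> c b * representation S x b \<longleftrightarrow> 0 \<le> representation ?T x (c b *\<^sub>R b)"
    if "x \<in> span S" "b \<in> S" for x b
  proof -
    have "c b * representation S x b = (c b * c b) * representation ?T x (c b *\<^sub>R b)"
      using representation_image_scale[OF S c that] by simp
    moreover have "c b * c b > 0" using c that by (meson not_real_square_gt_zero)
    ultimately show ?thesis by (simp only: zero_le_mult_iff) linarith
  qed
  then show ?thesis
    unfolding convex_cone_hull_independent[OF T] sp by auto
qed

lemma convex_cone_hull_singleton: "convex_cone hull {s} = {c *\<^sub>R s | c. 0 \<le> c}"
proof
  have "convex_cone {c *\<^sub>R s | c. 0 \<le> c}"
    unfolding convex_cone_iff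
    by (auto simp flip: scaleR_left_distrib intro: add_nonneg_nonneg mult_nonneg_nonneg exI[of _ 0])
  then show "convex_cone hull {s} \<subseteq> {c *\<^sub>R s | c. 0 \<le> c}"
    by (intro hull_minimal) (auto intro: exI[of _ 1])
qed (auto intro: convex_cone_hull_mul hull_inc)

lemma convex_cone_hull_singleton_scale:
  assumes "c > 0" shows "convex_cone hull {c *\<^sub>R u} = convex_cone hull {u}"
proof -
  have "\<exists>b. a *\<^sub>R u = b *\<^sub>R c *\<^sub>R u \<and> 0 \<le> b" if "0 \<le> a" for a
    using that assms by (intro exI[of _ "a / c"]) simp
  then show ?thesis using assms unfolding convex_cone_hull_singleton by fastforce
qed

section \<open>Complete simplicial fans with flat links\<close>

text \<open>The fan is recorded as the simplicial complex \<open>K\<close> of generating sets.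
  \<open>compat\<close> is the intersection axiom in coordinates: a generator that contributes to a
  common point of two cones generates both. \<open>h_adjacent\<close> is the flatness of the links:
  all neighbours of \<open>u\<close> lie on one hyperplane that misses \<open>u\<close>.\<close>

locale flat_link_fan =
  fixes K :: "'a::euclidean_space set set" and V :: "'a set" and h :: "'a \<Rightarrow> 'a \<Rightarrow> real"
  assumes finite_K: "finite K"
    and indep: "S \<in> K \<Longrightarrow> independent S"
    and subset_closed: "S \<in> K \<Longrightarrow> T \<subseteq> S \<Longrightarrow> T \<in> K"
    and compat: "\<lbrakk>S \<in> K; T \<in> K; x \<in> convex_cone hull S; x \<in> convex_cone hull T;
      representation S x b \<noteq> 0\<rbrakk> \<Longrightarrow> b \<in> T"
    and cover: "(\<Union>S\<in>K. convex_cone hull S) = V"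
    and subspace_V: "subspace V"
    and linear_h: "u \<in> \<Union>K \<Longrightarrow> linear (h u)"
    and h_self: "u \<in> \<Union>K \<Longrightarrow> h u u = 1"
    and h_adjacent: "\<lbrakk>u \<noteq> w; {u, w} \<in> K\<rbrakk> \<Longrightarrow> h u w = 0"
begin

section \<open>Coordinates and stars of rays\<close>

lemma finite_gens: "S \<in> K \<Longrightarrow> finite S"
  using indep finiteI_independent by blast

lemma gens_subset: "\<Union>K \<subseteq> V"
  using cover by (auto intro: hull_inc)

lemma span_gens: "span (\<Union>K) = V"
proof
  show "span (\<Union>K) \<subseteq> V" by (intro span_minimal gens_subset subspace_V)
  show "V \<subseteq> span (\<Union>K)"
  proof -
    have "convex_cone hull S \<subseteq> span (\<Union>K)" if "S \<in> K" for S
      using convex_cone_hull_subset_span[of S] span_mono[of S "\<Union>K"] that by blast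
    then show ?thesis unfolding cover[symmetric] by blast
  qed
qed

lemma gen_nonzero: "u \<in> \<Union>K \<Longrightarrow> u \<noteq> 0"
  using indep dependent_zero by blast

lemma singleton_in: "u \<in> \<Union>K \<Longrightarrow> {u} \<in> K"
  using subset_closed by blast

text \<open>Compare the cone with the ray of \<open>u\<close>, where the coordinate at
  \<open>u\<close> is 1. In particular distinct generators never lie on the same ray.\<close>

lemma mem_if_gen_in_cone:
  assumes "u \<in> \<Union>K" "S \<in> K" "u \<in> convex_cone hull S" shows "u \<in> S"
proof (rule compat[OF singleton_in[OF assms(1)] assms(2) _ assms(3)])
  show "u \<in> convex_cone hull {u}" by (simp add: hull_inc)
  show "representation {u} u u \<noteq> 0"
    using indep[OF singleton_in[OF assms(1)]] by (simp add: representation_basis)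
qed

text \<open>The other generators of a cone through \<open>u\<close> are adjacent to
  \<open>u\<close>, so \<open>h u\<close> and the coordinate at \<open>u\<close> agree on a basis of
  the span.\<close>

lemma h_eq_representation:
  assumes S: "S \<in> K" and u: "u \<in> S" and x: "x \<in> span S"
  shows "h u x = representation S x u"
proof -
  have uK: "u \<in> \<Union>K" using S u by blast
  have h_on_S: "h u b = (if b = u then 1 else 0)" if "b \<in> S" for b
    using h_self[OF uK] h_adjacent[of u b] subset_closed[OF S, of "{u, b}"] u that by auto
  have "h u x = h u (\<Sum>b\<in>S. representation S x b *\<^sub>R b)"
    using sum_representation_eq[OF indep[OF S] x finite_gens[OF S]] by simp
  also have "\<dots> = (\<Sum>b\<in>S. representation S x b * h u b)"
    using linear_h[OF uK] by (simp add: linear_sum linear_cmul)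
  also have "\<dots> = (\<Sum>b\<in>S. if b = u then representation S x b else 0)"
    by (rule sum.cong) (auto simp: h_on_S)
  also have "\<dots> = representation S x u"
    using finite_gens[OF S] u by simp
  finally show ?thesis .
qed

text \<open>A cone of the fan that contains \<open>u + t x\<close> for arbitrarily small \<open>t > 0\<close> contains \<open>u\<close>;
  its coefficient at \<open>u\<close> is read off by \<open>h u\<close>, so subtracting \<open>u\<close> stays inside the cone.\<close>

lemma halfspace_subset_star:
  assumes u: "u \<in> \<Union>K" and x: "x \<in> V" and hx: "0 \<le> h u x"
  shows "\<exists>S\<in>K. u \<in> S \<and> x \<in> convex_cone hull S"
proof -
  define y where "y n = u + (1 / real (Suc n)) *\<^sub>R x" for n
  have "y n \<in> V" for n
    unfolding y_def using subspace_V u x gens_subset by (auto intro!: subspace_add subspace_scale)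
  then have "\<forall>n. \<exists>S\<in>K. y n \<in> convex_cone hull S" using cover by blast
  then obtain F where F: "\<And>n. F n \<in> K" "\<And>n. y n \<in> convex_cone hull F n" by metis
  \<comment> \<open>With finitely many cones, one of them contains a whole subsequence of the points
    \<open>y n\<close>; being closed, it also contains their limit \<open>u\<close>.\<close>
  have "finite (range F)" using F(1) finite_K by (meson finite_subset image_subsetI)
  then obtain n0 where inf: "infinite {n \<in> UNIV. F n = F n0}"
    using pigeonhole_infinite[of UNIV F] by auto
  define S where "S = F n0"
  have S: "S \<in> K" using F by (simp add: S_def)
  obtain r :: "nat \<Rightarrow> nat" where r: "strict_mono r" "\<And>n. F (r n) = S"
    using infinite_enumerate[OF inf] by (auto simp: S_def)
  have "y \<longlonglongrightarrow> u + 0 *\<^sub>R x"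
    unfolding y_def by (intro tendsto_intros LIMSEQ_Suc[OF lim_1_over_n])
  then have "(y \<circ> r) \<longlonglongrightarrow> u"
    using LIMSEQ_subseq_LIMSEQ r(1) by fastforce
  moreover have "(y \<circ> r) n \<in> convex_cone hull S" for n
    using F(2)[of "r n"] r(2) by simp
  moreover have "closed (convex_cone hull S)"
    by (rule closed_convex_cone_hull[OF finite_gens[OF S]])
  ultimately have "u \<in> convex_cone hull S"
    using closed_sequentially by blast
  then have uS: "u \<in> S" by (rule mem_if_gen_in_cone[OF u S])
  define t where "t = real (Suc (r 0))"
  have t: "t > 0" by (simp add: t_def)
  have yS: "y (r 0) \<in> convex_cone hull S" using F(2)[of "r 0"] r(2) by simp
  have x_eq: "x = t *\<^sub>R (y (r 0) - u)"
    using t by (simp add: y_def t_def)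
  have sp: "y (r 0) \<in> span S" "u \<in> span S"
    using yS uS convex_cone_hull_subset_span by (auto simp: span_base)
  then have xsp: "x \<in> span S" unfolding x_eq by (intro span_scale span_diff)
  have "0 \<le> representation S x b" if b: "b \<in> S" for b
  proof (cases "b = u")
    case True
    then show ?thesis using h_eq_representation[OF S uS xsp] hx by simp
  next
    case False
    then have "representation S x b = t * representation S (y (r 0)) b"
      using sp uS unfolding x_eq
      by (simp add: indep[OF S] span_diff representation_scale representation_diff
          representation_basis)
    then show ?thesis
      using t yS b by (simp add: convex_cone_hull_independent[OF indep[OF S]])
  qed
  then have "x \<in> convex_cone hull S"
    using xsp by (simp add: convex_cone_hull_independent[OF indep[OF S]])
  then show ?thesis using S uS by blast
qed

section \<open>Nonadjacent and antipodal rays\<close>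

lemma h_neg_or_adjacent:
  assumes u: "u \<in> \<Union>K" and w: "w \<in> \<Union>K" and "u \<noteq> w" and nadj: "{u, w} \<notin> K"
  shows "h u w < 0"
proof (rule ccontr)
  assume "\<not> h u w < 0"
  \<comment> \<open>The star of \<open>u\<close> contains its nonnegative half-space, so a generator
    in that half-space lies in a cone through \<open>u\<close> and is adjacent to
    \<open>u\<close>.\<close>
  then obtain S where S: "S \<in> K" "u \<in> S" "w \<in> convex_cone hull S"
    using halfspace_subset_star[OF u, of w] gens_subset w by auto
  then have "w \<in> S" using mem_if_gen_in_cone w by blast
  then show False using S subset_closed[of S "{u, w}"] nadj by auto
qed

text \<open>The open half-spaces of two nonadjacent rays are disjoint, so the two hyperplanes agree.\<close>

lemma h_nonadjacent:
  assumes u: "u \<in> \<Union>K" and w: "w \<in> \<Union>K" and "u \<noteq> w" and nadj: "{u, w} \<notin> K" and x: "x \<in> V"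
  shows "h w x = h w u * h u x"
proof -
  interpret hu: linear "h u" using linear_h[OF u] .
  interpret hw: linear "h w" using linear_h[OF w] .
  have uV: "u \<in> V" using u gens_subset by blast
  have disjoint: "h w y \<le> 0" if y: "y \<in> V" and hy: "0 < h u y" for y
  proof (rule ccontr)
    assume wy: "\<not> h w y \<le> 0"
    obtain S where S: "S \<in> K" "u \<in> S" "y \<in> convex_cone hull S"
      using halfspace_subset_star[OF u y] hy by auto
    obtain T where T: "T \<in> K" "w \<in> T" "y \<in> convex_cone hull T"
      using halfspace_subset_star[OF w y] wy by auto
    \<comment> \<open>The value \<open>h u y > 0\<close> is the coordinate of \<open>y\<close> at
      \<open>u\<close>, so \<open>compat\<close> forces \<open>u\<close> into every cone through
      \<open>y\<close>, in particular into one that contains \<open>w\<close>.\<close>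
    have "representation S y u \<noteq> 0"
      using h_eq_representation[OF S(1,2)] S(3) convex_cone_hull_subset_span hy by fastforce
    then have "u \<in> T" using compat S T by blast
    then show False using T subset_closed[of T "{u, w}"] nadj by auto
  qed
  have le: "h w y \<le> 0" if y: "y \<in> V" and hy: "h u y = 0" for y
  proof (rule ccontr)
    assume pos: "\<not> h w y \<le> 0"
    \<comment> \<open>Moving \<open>y\<close> by \<open>e *\<^sub>R u\<close> makes
      \<open>h u\<close> positive, while this size of \<open>e\<close> changes \<open>h w\<close> by
      at most half of \<open>h w y\<close>; the \<open>+ 1\<close> avoids division by zero.\<close>
    define e where "e = h w y / (2 * (\<bar>h w u\<bar> + 1))"
    have e: "e > 0" using pos by (simp add: e_def)
    have "h w (y + e *\<^sub>R u) \<le> 0"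
    proof (rule disjoint)
      show "y + e *\<^sub>R u \<in> V" using y uV subspace_V by (simp add: subspace_add subspace_scale)
      show "0 < h u (y + e *\<^sub>R u)" using hy e h_self[OF u] by (simp add: hu.add hu.scale)
    qed
    then have "h w y + e * h w u \<le> 0" by (simp add: hw.add hw.scale)
    moreover have "e * \<bar>h w u\<bar> \<le> e * (\<bar>h w u\<bar> + 1)" using e by simp
    moreover have "e * (\<bar>h w u\<bar> + 1) = h w y / 2" 
      unfolding e_def by (simp add: field_simps)
    moreover have "- (e * \<bar>h w u\<bar>) \<le> e * h w u" 
      using e mult_left_mono[of "- \<bar>h w u\<bar>" "h w u" e] by simp
    ultimately show False using pos by linarith
  qed
  \<comment> \<open>Projection of \<open>x\<close> along \<open>u\<close> to the kernel of
    \<open>h u\<close>. Both \<open>z\<close> and \<open>-z\<close> satisfy the inequality just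
    shown, so \<open>h w\<close> vanishes on this kernel.\<close>
  define z where "z = x - h u x *\<^sub>R u"
  have zV: "z \<in> V" using x uV subspace_V by (simp add: z_def subspace_diff subspace_scale)
  have hz: "h u z = 0" by (simp add: z_def hu.diff hu.scale h_self[OF u])
  have "h w z \<le> 0" using le zV hz by blast
  moreover have "h w (- z) \<le> 0"
    by (rule le) (use zV hz subspace_V in \<open>auto simp: subspace_neg hu.neg\<close>)
  ultimately have "h w z = 0" by (simp add: hw.neg)
  then show ?thesis by (simp add: z_def hw.diff hw.scale)
qed

text \<open>Expand \<open>- u\<close> in a cone. Every generator \<open>b\<close> with a nonzero
  coefficient has \<open>h b u < 0\<close>, so it is not adjacent to \<open>u\<close> and
  \<open>h b\<close> is a multiple of \<open>h u\<close>. Two such generators \<open>w\<close> and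
  \<open>b\<close> would be adjacent to each other: then \<open>h w b = 0\<close> yields
  \<open>h u b = 0\<close>, and hence \<open>h b b = 0\<close>, contradicting
  \<open>h b b = 1\<close>. So \<open>- u\<close> lies on a single ray.\<close>

lemma antipode:
  assumes u: "u \<in> \<Union>K"
  obtains w c where "w \<in> \<Union>K" "c > 0" "w = - c *\<^sub>R u"
proof -
  have uV: "- u \<in> V" using u gens_subset subspace_V by (auto simp: subspace_neg)
  then obtain S where S: "S \<in> K" and uS: "- u \<in> convex_cone hull S" using cover by blast
  define r where "r b = representation S (- u) b" for b
  have r_nonneg: "0 \<le> r b" if "b \<in> S" for b
    using uS that by (simp add: r_def convex_cone_hull_independent[OF indep[OF S]])
  have usp: "- u \<in> span S" using uS convex_cone_hull_subset_span by blast
  have sum: "(\<Sum>b\<in>S. r b *\<^sub>R b) = - u"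
    unfolding r_def by (rule sum_representation_eq) (use S indep usp finite_gens in auto)
  have supp: "{u, b} \<notin> K \<and> u \<noteq> b \<and> h b u \<noteq> 0" if b: "b \<in> S" "r b \<noteq> 0" for b
  proof -
    have bK: "b \<in> \<Union>K" using b S by blast
    interpret hb: linear "h b" using linear_h[OF bK] .
    have "h b (- u) = r b" using h_eq_representation[OF S b(1) usp] by (simp add: r_def)
    then have neg: "h b u < 0" using r_nonneg[OF b(1)] b(2) by (simp add: hb.neg)
    then have "u \<noteq> b" using h_self[OF bK] by auto
    moreover have "{b, u} \<notin> K" using h_adjacent[of b u] neg \<open>u \<noteq> b\<close> by auto
    ultimately show ?thesis using neg by (simp add: insert_commute)
  qed
  obtain w where w: "w \<in> S" "r w \<noteq> 0"
    using sum gen_nonzero[OF u] by (metis (no_types, lifting) neg_equal_0_iff_equal scaleR_zero_left sum.neutral)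
  have zero: "r b = 0" if b: "b \<in> S" "b \<noteq> w" for b
  proof (rule ccontr)
    assume rb: "r b \<noteq> 0"
    have K: "w \<in> \<Union>K" "b \<in> \<Union>K" using S w b by auto
    have V: "w \<in> V" "b \<in> V" using K gens_subset by auto
    have "h w b = 0" using h_adjacent[of w b] subset_closed[OF S, of "{w, b}"] w b by auto
    moreover have "h w b = h w u * h u b"
      by (rule h_nonadjacent) (use supp[OF w] K V u in auto)
    ultimately have "h u b = 0" using supp[OF w] by simp
    moreover have "h b b = h b u * h u b"
      by (rule h_nonadjacent) (use supp[OF b(1) rb] K V u in auto)
    ultimately show False using h_self[OF K(2)] by simp
  qed
  have "(\<Sum>b\<in>S. r b *\<^sub>R b) = (\<Sum>b\<in>{w}. r b *\<^sub>R b)"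
    by (rule sum.mono_neutral_right) (use w zero finite_gens[OF S] in auto)
  then have "- u = r w *\<^sub>R w" using sum by simp
  then have "u = - (r w *\<^sub>R w)" by (metis minus_minus)
  then have "w = - (1 / r w) *\<^sub>R u" using w by simp
  moreover have "1 / r w > 0" using r_nonneg[OF w(1)] w(2) by simp
  ultimately show thesis using that w S by blast
qed

text \<open>Let \<open>v\<close> be the antipode of \<open>u\<close>. Since \<open>h w\<close> is
  negative on \<open>u\<close>, it is positive on \<open>v\<close>; but on a generator other than
  \<open>w\<close> it is zero or negative, according to adjacency. So \<open>v\<close> is
  \<open>w\<close>.\<close>

lemma nonadjacent_imp_antipodal:
  assumes u: "u \<in> \<Union>K" and w: "w \<in> \<Union>K" and ne: "u \<noteq> w" and nadj: "{u, w} \<notin> K"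
  obtains c where "c > 0" "w = - c *\<^sub>R u"
proof -
  obtain v c where v: "v \<in> \<Union>K" "c > 0" "v = - c *\<^sub>R u" using antipode[OF u] .
  have "h w u < 0"
    by (rule h_neg_or_adjacent) (use assms in \<open>auto simp: insert_commute\<close>)
  moreover have "h w v = - c * h w u"
    using linear_h[OF w] v(3) by (simp add: linear_neg linear_cmul)
  ultimately have pos: "h w v > 0" using v(2) by (simp add: mult_pos_neg)
  have "w = v"
  proof (rule ccontr)
    assume "w \<noteq> v"
    then show False
      using h_neg_or_adjacent[OF w v(1)] h_adjacent[of w v] pos by (cases "{w, v} \<in> K") auto
  qed
  then show thesis using that v by blast
qed

section \<open>A basis of rays and the orthants it cuts out\<close>

lemma rays_cones: "rays ((hull) convex_cone ` K) = (\<lambda>u. convex_cone hull {u}) ` \<Union>K"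
proof -
  have "dim (convex_cone hull S) = 1 \<longleftrightarrow> (\<exists>u. S = {u})" if "S \<in> K" for S
    using dim_convex_cone_hull[OF indep[OF that]] by (auto simp: card_1_singleton_iff)
  then have "rays ((hull) convex_cone ` K) = {convex_cone hull {u} | u. {u} \<in> K}"
    unfolding rays_def by blast
  moreover have "{u} \<in> K \<longleftrightarrow> u \<in> \<Union>K" for u
    using singleton_in by blast
  ultimately show ?thesis by (simp add: Setcompr_eq_image del: Union_iff)
qed

text \<open>Take a maximal independent set of generators. A further generator antipodal to none of
  them is adjacent to all of them, so every \<open>h b\<close> kills it; as these functionals are
  dual to the basis, it would be zero.\<close>

lemma gen_basis:
  obtains B where "B \<subseteq> \<Union>K" "independent B" "span B = V"
    "\<And>u. u \<in> \<Union>K \<Longrightarrow> u \<in> B \<or> (\<exists>b\<in>B. \<exists>c>0. u = - c *\<^sub>R b)"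
proof -
  obtain B where B: "B \<subseteq> \<Union>K" "independent B" "\<Union>K \<subseteq> span B"
    by (rule maximal_independent_subset)
  have fin: "finite B" using B(2) by (rule finiteI_independent)
  have span: "span B = V"
    using span_gens B span_mono span_minimal[OF B(3) subspace_span] by blast
  have "u \<in> B \<or> (\<exists>b\<in>B. \<exists>c>0. u = - c *\<^sub>R b)" if u: "u \<in> \<Union>K" for u
  proof (rule ccontr)
    assume neg: "\<not> ?thesis"
    have zero: "h b u = 0" if b: "b \<in> B" for b
    proof (cases "{b, u} \<in> K")
      case True
      then show ?thesis using h_adjacent[of b u] neg b by blast
    next
      case False
      have "b \<in> \<Union>K" "b \<noteq> u" using b B neg by auto
      then show ?thesis using nonadjacent_imp_antipodal[OF _ u _ False] neg b by metis
    qed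
    \<comment> \<open>Independence excludes antipodal pairs inside \<open>B\<close>, so distinct
      members are adjacent.\<close>
    have orth: "h b a = (if a = b then 1 else 0)" if ab: "a \<in> B" "b \<in> B" for a b
    proof (cases "a = b")
      case False
      have K: "a \<in> \<Union>K" "b \<in> \<Union>K" using ab B by auto
      show ?thesis
      proof (cases "{b, a} \<in> K")
        case True
        then show ?thesis using h_adjacent[of b a] False by simp
      next
        case nadj: False
        obtain c where "a = - c *\<^sub>R b"
          using nonadjacent_imp_antipodal[OF K(2,1) False[symmetric] nadj] by metis
        then show ?thesis
          using independent_scaleR_imp_eq[OF B(2) ab] False by blast
      qed
    qed (use ab B h_self in auto)
    have rep: "u = (\<Sum>a\<in>B. representation B u a *\<^sub>R a)"
      using sum_representation_eq[OF B(2) _ fin] u B(3) by (metis order_refl subsetD)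
    have "representation B u b = 0" if b: "b \<in> B" for b
    proof -
      have "h b u = (\<Sum>a\<in>B. representation B u a * h b a)"
        using linear_h[OF subsetD[OF B(1) b]] by (subst rep) (simp add: linear_sum linear_cmul)
      also have "\<dots> = (\<Sum>a\<in>B. if a = b then representation B u a else 0)"
        by (rule sum.cong) (auto simp: orth b)
      finally show ?thesis using zero[OF b] b fin by simp
    qed
    then have "u = 0" using rep by simp
    then show False using gen_nonzero u by blast
  qed
  then show thesis using that B span by blast
qed

text \<open>The maximal cones are found by comparison with the orthants \<open>C s\<close>: each
  orthant belongs to the fan, each cone of the fan lies in an orthant, and distinct orthants are
  incomparable.\<close>

theorem cross_polytope_fan_cones: "cross_polytope_fan (dim V) ((hull) convex_cone ` K)"
proof -
  obtain B where B: "B \<subseteq> \<Union>K" "independent B" "span B = V"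
    and B_gens: "\<And>u. u \<in> \<Union>K \<Longrightarrow> u \<in> B \<or> (\<exists>b\<in>B. \<exists>c>0. u = - c *\<^sub>R b)"
    by (rule gen_basis) blast
  have finB: "finite B" using B(2) by (rule finiteI_independent)
  have dim: "dim V = card B" using dim_span_eq_card_independent[OF B(2)] B(3) by simp
  define C where "C s = convex_cone hull ((\<lambda>b. s b *\<^sub>R b) ` B)" for s
  define signs where "signs = {s :: 'a \<Rightarrow> real. \<forall>b\<in>B. s b \<in> {1, -1}}"
  have C_eq: "C s = {x \<in> V. \<forall>b\<in>B. 0 \<le> s b * representation B x b}" if "s \<in> signs" for s
    unfolding C_def B(3)[symmetric]
    by (rule convex_cone_hull_image_scale[OF B(2)]) (use that in \<open>auto simp: signs_def\<close>)
  have rep_B: "representation B (c *\<^sub>R b) a = (if a = b then c else 0)" if "b \<in> B" for a b c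
    using that by (simp add: B(2) representation_scale span_base representation_basis)
  have C_subset_D: "s b = t b" if "C s \<subseteq> C t" "s \<in> signs" "t \<in> signs" "b \<in> B" for s t b
  proof -
    \<comment> \<open>The signed basis vector itself detects the sign at \<open>b\<close>.\<close>
    have "s b *\<^sub>R b \<in> C s" using that by (auto simp: C_def intro!: hull_inc)
    then have "s b *\<^sub>R b \<in> C t" using that by blast
    then have "0 \<le> t b * s b" using that by (auto simp: C_eq rep_B)
    moreover have "s b \<in> {1, -1}" "t b \<in> {1, -1}" using that by (auto simp: signs_def)
    ultimately show ?thesis by auto
  qed
  have C_cong: "C s = C t" if "\<And>b. b \<in> B \<Longrightarrow> s b = t b" for s t
    unfolding C_def using that by (simp cong: image_cong)
  have antipode_B: "\<exists>w\<in>\<Union>K. \<exists>c>0. w = (c * s b) *\<^sub>R b"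
    if b: "b \<in> B" and "s \<in> signs" for b s
  proof (cases "s b = 1")
    case True
    then show ?thesis using that B by (intro bexI[of _ b] exI[of _ 1]) auto
  next
    case False
    then have "s b = -1" using that by (auto simp: signs_def)
    moreover obtain w c where "w \<in> \<Union>K" "c > 0" "w = - c *\<^sub>R b"
      using antipode[of b] b B by blast
    ultimately show ?thesis by (intro bexI[of _ w] exI[of _ c]) auto
  qed
  have C_in: "C s \<in> (hull) convex_cone ` K" if s: "s \<in> signs" for s
  proof -
    \<comment> \<open>The fan generator on the ray of \<open>s b *\<^sub>R b\<close> may be a
      different positive multiple; \<open>r b\<close> records the factor.\<close>
    obtain r where r: "\<And>b. b \<in> B \<Longrightarrow> r b > 0" "\<And>b. b \<in> B \<Longrightarrow> (r b * s b) *\<^sub>R b \<in> \<Union>K"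
      using antipode_B[OF _ s] by metis
    have ne: "s b \<noteq> 0" "r b \<noteq> 0" if "b \<in> B" for b
      using s r(1)[OF that] that by (auto simp: signs_def)
    define w where "w b = (r b * s b) *\<^sub>R b" for b
    have wK: "w b \<in> \<Union>K" if "b \<in> B" for b using r(2)[OF that] by (simp add: w_def)
    have adj: "h (w a) (w b) = (if a = b then 1 else 0)" if ab: "a \<in> B" "b \<in> B" for a b
    proof (cases "a = b")
      case False
      have not_mult: "w b \<noteq> k *\<^sub>R w a" for k
      proof
        assume "w b = k *\<^sub>R w a"
        then have "representation B (w b) b = representation B (k *\<^sub>R w a) b" by simp
        then show False using ab False ne by (simp add: w_def rep_B)
      qed
      then have "{w a, w b} \<in> K"
        using nonadjacent_imp_antipodal[OF wK[OF ab(1)] wK[OF ab(2)]] not_mult[of 1]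
        by (metis scaleR_one)
      then show ?thesis using h_adjacent[of "w a" "w b"] not_mult[of 1] False by auto
    qed (use wK[OF ab(1)] h_self in auto)
    \<comment> \<open>A point with every orthant coordinate positive. Each \<open>h (w b)\<close> is
      1 on it, so \<open>compat\<close> puts each \<open>w b\<close> into any cone containing it,
      and the dimension bound leaves no room for further generators.\<close>
    define x where "x = (\<Sum>b\<in>B. w b)"
    have "x \<in> V"
      unfolding x_def using wK gens_subset by (intro subspace_sum subspace_V) blast
    then obtain S where S: "S \<in> K" and xS: "x \<in> convex_cone hull S" using cover by blast
    have "w b \<in> S" if b: "b \<in> B" for b
    proof -
      have "h (w b) x = (\<Sum>a\<in>B. h (w b) (w a))"
        unfolding x_def using linear_h[OF wK[OF b]] by (simp add: linear_sum)
      also have "\<dots> = (\<Sum>a\<in>B. if a = b then 1 else 0)"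
        by (rule sum.cong) (auto simp: adj b)
      finally have hx: "h (w b) x = 1" using b finB by simp
      then obtain T where T: "T \<in> K" "w b \<in> T" "x \<in> convex_cone hull T"
        using halfspace_subset_star[OF wK[OF b] \<open>x \<in> V\<close>] by auto
      then have "representation T x (w b) = 1"
        using h_eq_representation[OF T(1,2), of x] hx convex_cone_hull_subset_span by auto
      then show ?thesis using compat[OF T(1) S T(3) xS] by simp
    qed
    then have sub: "w ` B \<subseteq> S" by blast
    have "inj_on w B"
      using adj by (intro inj_onI) (metis zero_neq_one)
    then have "card (w ` B) = dim V" using dim by (simp add: card_image)
    moreover have "card S \<le> dim V"
      using independent_card_le_dim[OF _ indep[OF S]] S gens_subset by blast
    ultimately have "w ` B = S"
      using sub finite_gens[OF S] by (intro card_seteq) auto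
    moreover have "convex_cone hull (w ` B) = {x \<in> V. \<forall>b\<in>B. 0 \<le> (r b * s b) * representation B x b}"
      unfolding w_def B(3)[symmetric]
      by (rule convex_cone_hull_image_scale[OF B(2)]) (use ne in auto)
    moreover have "0 \<le> (r b * s b) * y \<longleftrightarrow> 0 \<le> s b * y" if "b \<in> B" for b y
      using r(1)[OF that] by (simp add: mult.assoc zero_le_mult_iff)
    ultimately have "convex_cone hull S = C s" by (auto simp: C_eq[OF s])
    then show ?thesis using S by blast
  qed
  have in_C: "\<exists>s\<in>signs. convex_cone hull S \<subseteq> C s" if S: "S \<in> K" for S
  proof -
    \<comment> \<open>A generator in \<open>S\<close> outside \<open>B\<close> is antipodal to some
      \<open>b\<close>, which then cannot be in \<open>S\<close>, so -1 is the right sign. If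
      \<open>S\<close> meets neither ray of a pair, the sign is arbitrary.\<close>
    define s where "s b = (if b \<in> S then 1 else -1 :: real)" for b
    have s: "s \<in> signs" by (auto simp: s_def signs_def)
    have "u \<in> C s" if u: "u \<in> S" for u
    proof (cases "u \<in> B")
      case True
      then have "s u *\<^sub>R u \<in> C s" unfolding C_def by (intro hull_inc) blast
      then show ?thesis using u by (simp add: s_def)
    next
      case False
      then obtain b c where bc: "b \<in> B" "c > 0" "u = - c *\<^sub>R b" using B_gens u S by blast
      have "b \<notin> S"
      proof
        assume b: "b \<in> S"
        then have "u = b" using independent_scaleR_imp_eq[OF indep[OF S] u _ bc(3)] by blast
        then show False using False bc by blast
      qed
      have "s b *\<^sub>R b \<in> C s" unfolding C_def using bc by (intro hull_inc) blast
      then have "c *\<^sub>R (s b *\<^sub>R b) \<in> C s"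
        unfolding C_def by (rule convex_cone_hull_mul) (use bc in simp)
      then show ?thesis using \<open>b \<notin> S\<close> by (simp add: s_def bc(3))
    qed
    then have "convex_cone hull S \<subseteq> C s"
      by (intro hull_minimal) (auto simp: C_def convex_cone_convex_cone_hull)
    then show ?thesis using s by blast
  qed
  have maximal: "maximal_cones ((hull) convex_cone ` K) = C ` signs"
  proof
    show "C ` signs \<subseteq> maximal_cones ((hull) convex_cone ` K)"
    proof
      fix D assume "D \<in> C ` signs"
      then obtain s where s: "s \<in> signs" and D: "D = C s" by blast
      have "convex_cone hull S = C s" if S: "S \<in> K" and sub: "C s \<subseteq> convex_cone hull S" for S
      proof -
        obtain t where t: "t \<in> signs" "convex_cone hull S \<subseteq> C t" using in_C[OF S] by blast
        then have "C s = C t" using sub s by (intro C_cong C_subset_D) auto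
        then show ?thesis using t sub by blast
      qed
      then show "D \<in> maximal_cones ((hull) convex_cone ` K)"
        unfolding maximal_cones_def D using C_in[OF s] by auto
    qed
    show "maximal_cones ((hull) convex_cone ` K) \<subseteq> C ` signs"
    proof
      fix D assume D: "D \<in> maximal_cones ((hull) convex_cone ` K)"
      then obtain S where S: "S \<in> K" "D = convex_cone hull S" by (auto simp: maximal_cones_def)
      then obtain s where s: "s \<in> signs" "D \<subseteq> C s" using in_C by blast
      then have "C s = D" using D C_in[OF s(1)] unfolding maximal_cones_def by blast
      then show "D \<in> C ` signs" using s by blast
    qed
  qed
  have rays: "rays ((hull) convex_cone ` K)
      = (\<lambda>b. convex_cone hull {b}) ` B \<union> (\<lambda>b. convex_cone hull {- b}) ` B"
  proof -
    have "convex_cone hull {u} \<in> (\<lambda>b. convex_cone hull {b}) ` B \<union> (\<lambda>b. convex_cone hull {- b}) ` B"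
      if u: "u \<in> \<Union>K" for u
    proof (cases "u \<in> B")
      case False
      then obtain b c where "b \<in> B" "c > 0" "u = c *\<^sub>R (- b)" using B_gens[OF u] by auto
      then show ?thesis using convex_cone_hull_singleton_scale[of c "- b"] by blast
    qed blast
    moreover have "convex_cone hull {- b} \<in> (\<lambda>u. convex_cone hull {u}) ` \<Union>K" if b: "b \<in> B" for b
    proof -
      obtain w c where w: "w \<in> \<Union>K" "c > 0" "w = - c *\<^sub>R b"
        using antipode[of b] b B by blast
      then have "convex_cone hull {w} = convex_cone hull {- b}" using convex_cone_hull_singleton_scale[of c "- b"] by simp
      then show ?thesis using w by (metis imageI)
    qed
    ultimately show ?thesis unfolding rays_cones using B(1) by auto
  qed
  obtain v where v: "bij_betw v {..<dim V} B"
    using ex_bij_betw_nat_finite[OF finB] dim by (auto simp: atLeast0LessThan)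
  have vB: "v ` {..<dim V} = B" and inj: "inj_on v {..<dim V}"
    using v by (auto simp: bij_betw_def)
  have "C ` signs = {convex_cone hull {s i *\<^sub>R v i | i. i < dim V} | s. \<forall>i<dim V. s i \<in> {1, -1}}"
    (is "_ = ?R")
  proof
    have eq: "C s = convex_cone hull {s (v i) *\<^sub>R v i | i. i < dim V}" for s
      unfolding C_def vB[symmetric] by (rule arg_cong[where f="(hull) convex_cone"]) auto
    show "C ` signs \<subseteq> ?R"
    proof
      fix D assume "D \<in> C ` signs"
      then obtain s where "s \<in> signs" "D = C s" by blast
      then show "D \<in> ?R"
        using eq[of s] vB by (auto simp: signs_def intro!: exI[of _ "s \<circ> v"])
    qed
    show "?R \<subseteq> C ` signs"
    proof
      fix D assume "D \<in> ?R"
      then obtain s where s: "\<forall>i<dim V. s i \<in> {1, -1}"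
        and D: "D = convex_cone hull {s i *\<^sub>R v i | i. i < dim V}" by blast
      define t where "t = s \<circ> the_inv_into {..<dim V} v"
      have tv: "t (v i) = s i" if "i < dim V" for i
        using that by (simp add: t_def the_inv_into_f_f[OF inj])
      have "t \<in> signs" unfolding signs_def vB[symmetric] using s tv by auto
      moreover have "{t (v i) *\<^sub>R v i | i. i < dim V} = {s i *\<^sub>R v i | i. i < dim V}"
        using tv by force
      then have "D = C t" unfolding D eq by simp
      ultimately show "D \<in> C ` signs" by blast
    qed
  qed
  moreover have "(\<lambda>b. convex_cone hull {b}) ` B \<union> (\<lambda>b. convex_cone hull {- b}) ` B
      = {convex_cone hull {v i} | i. i < dim V} \<union> {convex_cone hull {- v i} | i. i < dim V}"
    unfolding vB[symmetric] by auto
  ultimately show ?thesis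
    unfolding cross_polytope_fan_def maximal rays
    using inj vB B(2) by (intro exI[of _ v]) auto
qed

end

section \<open>Lattices and normal generators\<close>

lemma span_sum_scale: "A \<subseteq> B \<Longrightarrow> (\<Sum>b\<in>A. c b *\<^sub>R b) \<in> span B"
  by (intro span_sum span_scale) (auto simp: span_base)

lemma representation_sum_scale:
  fixes B :: "'a::euclidean_space set"
  assumes B: "independent B" and A: "A \<subseteq> B"
  shows "representation B (\<Sum>b\<in>A. c b *\<^sub>R b) a = (if a \<in> A then c a else 0)"
proof -
  have fin: "finite A" using finiteI_independent[OF B] A by (rule finite_subset[rotated])
  have sp: "b \<in> span B" if "b \<in> A" for b using that A by (auto simp: span_base)
  have "representation B (\<Sum>b\<in>A. c b *\<^sub>R b) a = (\<Sum>b\<in>A. representation B (c b *\<^sub>R b) a)"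
    using sp by (subst representation_sum[OF B]) (auto simp: span_scale)
  also have "\<dots> = (\<Sum>b\<in>A. if b = a then c b else 0)"
    using A sp by (intro sum.cong)
      (auto simp: representation_scale[OF B] representation_basis[OF B])
  finally show ?thesis using fin by simp
qed

text \<open>\<open>representation\<close> is additive only on \<open>span B\<close>, whereas
  characters and norm bounds call for a functional that is linear on the whole ambient
  space.\<close>

lemma coordinate_functional:
  fixes B :: "'a::euclidean_space set"
  assumes B: "independent B" and b: "b \<in> B"
  obtains g :: "'a \<Rightarrow> real" where "linear g" "\<And>x. x \<in> span B \<Longrightarrow> g x = representation B x b"
proof -
  obtain g :: "'a \<Rightarrow> real" where g: "linear g" "\<forall>x\<in>B. g x = (if x = b then 1 else 0)"
    using linear_independent_extend[OF B, of "\<lambda>x. if x = b then 1 else 0"] by blast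
  have fin: "finite B" using B by (rule finiteI_independent)
  have "g x = representation B x b" if x: "x \<in> span B" for x
  proof -
    have "g x = g (\<Sum>a\<in>B. representation B x a *\<^sub>R a)"
      using sum_representation_eq[OF B x fin] by simp
    also have "\<dots> = (\<Sum>a\<in>B. if a = b then representation B x a else 0)"
      unfolding linear_sum[OF g(1)] by (rule sum.cong) (auto simp: linear_cmul[OF g(1)] g(2))
    finally show ?thesis using fin b by simp
  qed
  then show thesis using that g(1) by blast
qed

lemma lattice_basis_representation:
  assumes "lattice_basis N B"
  shows "N = {x \<in> span B. \<forall>b\<in>B. representation B x b \<in> \<int>}"
proof -
  have B: "independent B" "finite B" and N: "N = {\<Sum>b\<in>B. of_int (k b) *\<^sub>R b | k. True}"
    using assms by (auto simp: lattice_basis_def)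
  have rep: "representation B (\<Sum>b\<in>B. c b *\<^sub>R b) a = c a" if "a \<in> B" for c a
    using representation_sum_scale[OF B(1) order_refl, of c a] that by simp
  show ?thesis
  proof
    show "N \<subseteq> {x \<in> span B. \<forall>b\<in>B. representation B x b \<in> \<int>}"
      unfolding N using rep by (auto simp: span_sum_scale)
    show "{x \<in> span B. \<forall>b\<in>B. representation B x b \<in> \<int>} \<subseteq> N"
    proof
      fix x assume x: "x \<in> {x \<in> span B. \<forall>b\<in>B. representation B x b \<in> \<int>}"
      then have "x = (\<Sum>b\<in>B. of_int \<lfloor>representation B x b\<rfloor> *\<^sub>R b)"
        using sum_representation_eq[OF B(1) _ B(2) order_refl, of x]
        by (auto elim!: Ints_cases simp: of_int_floor_cancel cong: sum.cong)
      then show "x \<in> N"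
        unfolding N by (intro CollectI exI[of _ "\<lambda>b. \<lfloor>representation B x b\<rfloor>"] conjI TrueI)
    qed
  qed
qed

lemma is_latticeE:
  assumes "is_lattice N"
  obtains B where "lattice_basis N B" "independent B" "finite B" "B \<subseteq> N" "span N = span B"
    "N = {x \<in> span B. \<forall>b\<in>B. representation B x b \<in> \<int>}"
proof -
  obtain B where B: "lattice_basis N B" using assms by (auto simp: is_lattice_def)
  then have ind: "independent B" "finite B" by (auto simp: lattice_basis_def)
  note N = lattice_basis_representation[OF B]
  have BN: "B \<subseteq> N"
    by (subst N) (auto simp: span_base representation_basis[OF ind(1)])
  have "N \<subseteq> span B" using N by blast
  then have "span N = span B"
    using BN span_mono span_minimal[OF _ subspace_span] by blast
  then show thesis using that B ind BN N by blast
qed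

lemma lattice_add_scale:
  assumes "is_lattice N" "x \<in> N" "y \<in> N" shows "x + of_int k *\<^sub>R y \<in> N"
proof -
  obtain B where B: "independent B" and N: "N = {x \<in> span B. \<forall>b\<in>B. representation B x b \<in> \<int>}"
    using assms(1) by (rule is_latticeE)
  show ?thesis
    using assms(2,3) B unfolding N
    by (auto simp: representation_add representation_scale span_scale intro!: span_add span_scale)
qed

lemma lattice_diff_sum:
  assumes N: "is_lattice N" and x: "x \<in> N" and T: "T \<subseteq> N"
  shows "x - (\<Sum>b\<in>T. of_int (k b) *\<^sub>R b) \<in> N"
  using T
proof (induction T rule: infinite_finite_induct)
  case (insert b T)
  then have "(x - (\<Sum>b\<in>T. of_int (k b) *\<^sub>R b)) + of_int (- k b) *\<^sub>R b \<in> N"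
    by (intro lattice_add_scale[OF N]) auto
  then show ?case using insert by (simp add: algebra_simps)
qed (use x in auto)

text \<open>Each coordinate is bounded by a multiple of the norm, so a norm bound leaves finitely
  many integral coordinate vectors.\<close>

lemma lattice_discrete:
  fixes N :: "'a::euclidean_space set"
  assumes "is_lattice N" shows "finite {x \<in> N. norm x \<le> r}"
proof -
  obtain B where B: "independent B" "finite B"
    and N: "N = {x \<in> span B. \<forall>b\<in>B. representation B x b \<in> \<int>}"
    using assms by (rule is_latticeE)
  have "\<exists>M. \<forall>x\<in>span B. \<bar>representation B x b\<bar> \<le> M * norm x" if b: "b \<in> B" for b
  proof -
    obtain g :: "'a \<Rightarrow> real" where g: "linear g" "\<And>x. x \<in> span B \<Longrightarrow> g x = representation B x b"
      using coordinate_functional[OF B(1) b] by blast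
    obtain M where "\<And>x. norm (g x) \<le> M * norm x"
      using linear_bounded[OF g(1)] by blast
    then show ?thesis using g(2) by (metis real_norm_def)
  qed
  then obtain M where M: "\<And>b x. b \<in> B \<Longrightarrow> x \<in> span B \<Longrightarrow> \<bar>representation B x b\<bar> \<le> M b * norm x"
    by metis
  define A where "A b = {\<lfloor>- \<bar>M b\<bar> * r\<rfloor>..\<lceil>\<bar>M b\<bar> * r\<rceil>}" for b
  have "{x \<in> N. norm x \<le> r} \<subseteq> (\<lambda>k. \<Sum>b\<in>B. of_int (k b) *\<^sub>R b) ` PiE B A"
  proof
    fix x assume x: "x \<in> {x \<in> N. norm x \<le> r}"
    then have xB: "x \<in> span B" using N by blast
    define k where "k = (\<lambda>b\<in>B. \<lfloor>representation B x b\<rfloor>)"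
    have k: "of_int (k b) = representation B x b" if "b \<in> B" for b
      using x that unfolding N by (auto simp: k_def of_int_floor_cancel elim!: Ints_cases)
    have "k b \<in> A b" if b: "b \<in> B" for b
    proof -
      have "\<bar>representation B x b\<bar> \<le> M b * norm x" by (rule M[OF b xB])
      also have "\<dots> \<le> \<bar>M b\<bar> * r" using x by (intro mult_mono) auto
      finally have "\<bar>of_int (k b)\<bar> \<le> \<bar>M b\<bar> * r" using k[OF b] by simp
      then show ?thesis unfolding A_def by (simp add: abs_le_iff) linarith
    qed
    then have "k \<in> PiE B A" by (auto simp: k_def)
    moreover have "x = (\<Sum>b\<in>B. of_int (k b) *\<^sub>R b)"
      using sum_representation_eq[OF B(1) xB B(2) order_refl] k by simp
    ultimately show "x \<in> (\<lambda>k. \<Sum>b\<in>B. of_int (k b) *\<^sub>R b) ` PiE B A" by blast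
  qed
  moreover have "finite (PiE B A)" using B(2) by (intro finite_PiE) (auto simp: A_def)
  ultimately show ?thesis by (meson finite_imageI finite_subset)
qed

text \<open>Modulo the lattice points of \<open>S - {s}\<close>, every lattice point of \<open>span S\<close> has its other
  coordinates in \<open>[0, 1)\<close>; by discreteness the positive \<open>s\<close>-coordinates have a least element.\<close>

lemma normal_gen_exists:
  fixes N :: "'a::euclidean_space set"
  assumes N: "is_lattice N" and S: "independent S" "S \<subseteq> N" and s: "s \<in> S"
  shows "\<exists>v. v \<in> N \<inter> convex_cone hull S \<and>
    N \<inter> span (convex_cone hull S)
      = {x + of_int k *\<^sub>R v | x k. x \<in> N \<inter> span (convex_cone hull (S - {s}))}"
  unfolding span_convex_cone_hull
proof -
  define f where "f x = representation S x s" for x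
  have fin: "finite S" using S(1) by (rule finiteI_independent)
  define red where "red x = x - (\<Sum>b\<in>S - {s}. of_int \<lfloor>representation S x b\<rfloor> *\<^sub>R b)" for x
  have red_span: "red x \<in> span S" if "x \<in> span S" for x
    unfolding red_def by (rule span_diff[OF that]) (simp add: span_sum_scale)
  have red_N: "red x \<in> N" if "x \<in> N" for x
    unfolding red_def using N that S(2) by (intro lattice_diff_sum) auto
  have rep_red: "representation S (red x) b
      = (if b = s then f x else representation S x b - of_int \<lfloor>representation S x b\<rfloor>)"
    if x: "x \<in> span S" and b: "b \<in> S" for x b
  proof -
    let ?c = "\<lambda>b. of_int \<lfloor>representation S x b\<rfloor>"
    have "representation S (\<Sum>a\<in>S - {s}. ?c a *\<^sub>R a) b = (if b \<in> S - {s} then ?c b else 0)"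
      by (rule representation_sum_scale[OF S(1)]) blast
    moreover have "(\<Sum>a\<in>S - {s}. ?c a *\<^sub>R a) \<in> span S"
      by (rule span_sum_scale) blast
    ultimately show ?thesis
      using b unfolding red_def f_def
      by (cases "b = s") (simp_all add: representation_diff[OF S(1) _ x])
  qed
  \<comment> \<open>The cut-off 1 is attained by \<open>s\<close>, so \<open>P\<close> is nonempty.
    After reduction it bounds the norms, which leaves finitely many values of
    \<open>f\<close>.\<close>
  define P where "P = {x \<in> N \<inter> span S. 0 < f x \<and> f x \<le> 1}"
  have "f ` P \<subseteq> f ` {y \<in> N. norm y \<le> (\<Sum>b\<in>S. norm b)}"
  proof
    fix t assume "t \<in> f ` P"
    then obtain x where x: "x \<in> N" "x \<in> span S" "0 < f x" "f x \<le> 1" "t = f x"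
      by (auto simp: P_def)
    have "red x = (\<Sum>b\<in>S. representation S (red x) b *\<^sub>R b)"
      using sum_representation_eq[OF S(1) red_span[OF x(2)] fin order_refl] by simp
    also have "norm \<dots> \<le> (\<Sum>b\<in>S. norm b)"
    proof (rule sum_norm_le)
      fix b assume b: "b \<in> S"
      have "\<bar>representation S (red x) b\<bar> \<le> 1"
        using x(3,4) unfolding rep_red[OF x(2) b] by (simp add: abs_le_iff) linarith
      then show "norm (representation S (red x) b *\<^sub>R b) \<le> norm b"
        by (simp add: mult_left_le_one_le)
    qed
    finally have "norm (red x) \<le> (\<Sum>b\<in>S. norm b)" .
    moreover have "f (red x) = t" using rep_red[OF x(2) s] x(5) by (simp add: f_def)
    ultimately show "t \<in> f ` {y \<in> N. norm y \<le> (\<Sum>b\<in>S. norm b)}"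
      using red_N[OF x(1)] by blast
  qed
  then have finP: "finite (f ` P)" using lattice_discrete[OF N] finite_subset by blast
  have "s \<in> P"
    using s S by (auto simp: P_def f_def span_base representation_basis)
  then have "Min (f ` P) \<in> f ` P" using finP by (intro Min_in) auto
  then obtain v0 where v0: "v0 \<in> P" "f v0 = Min (f ` P)" by (metis imageE)
  have min: "f v0 \<le> f x" if "x \<in> P" for x using that finP v0(2) by simp
  \<comment> \<open>Reduction keeps the \<open>s\<close>-coordinate and makes the other coordinates
    nonnegative, which places \<open>v\<close> in the cone.\<close>
  define v where "v = red v0"
  have v0': "v0 \<in> N" "v0 \<in> span S" "0 < f v0" "f v0 \<le> 1" using v0(1) by (auto simp: P_def)
  have vN: "v \<in> N" and vS: "v \<in> span S" and fv: "f v = f v0"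
    using red_N red_span rep_red[OF v0'(2) s] v0' by (auto simp: v_def f_def)
  have "0 \<le> representation S v b" if "b \<in> S" for b
    unfolding v_def rep_red[OF v0'(2) that] using v0'(3) by simp
  then have v_cone: "v \<in> convex_cone hull S"
    using vS by (simp add: convex_cone_hull_independent[OF S(1)])
  have f_add: "f (x + c *\<^sub>R v) = f x + c * f v" if "x \<in> span S" for x c
    using that vS by (simp add: f_def S(1) representation_add representation_scale span_scale)
  have "N \<inter> span S = {x + of_int k *\<^sub>R v | x k. x \<in> N \<inter> span (S - {s})}"
  proof
    show "{x + of_int k *\<^sub>R v | x k. x \<in> N \<inter> span (S - {s})} \<subseteq> N \<inter> span S"
      using span_mono[of "S - {s}" S] vN vS by (auto intro!: lattice_add_scale[OF N] span_add span_scale)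
    show "N \<inter> span S \<subseteq> {x + of_int k *\<^sub>R v | x k. x \<in> N \<inter> span (S - {s})}"
    proof
      fix y assume y: "y \<in> N \<inter> span S"
      \<comment> \<open>Division with remainder: the remainder \<open>f x\<close> lies between 0 and
        \<open>f v\<close>, excluding \<open>f v\<close>, so minimality makes it zero.\<close>
      define k where "k = \<lfloor>f y / f v\<rfloor>"
      define x where "x = y + of_int (- k) *\<^sub>R v"
      have x: "x \<in> N" "x \<in> span S"
        unfolding x_def using y vN vS by (auto intro!: lattice_add_scale[OF N] span_add span_scale simp del: of_int_minus)
      have fx: "f x = f y - of_int k * f v" unfolding x_def using y f_add[of y "of_int (- k)"] by simp
      have pos: "f v > 0" using fv v0' by simp
      have "of_int k \<le> f y / f v" "f y / f v < of_int k + 1" by (simp_all add: k_def)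
      then have "0 \<le> f x" "f x < f v" using pos unfolding fx by (simp_all add: field_simps)
      then have "f x = 0" using min[of x] x fv v0' by (fastforce simp: P_def)
      then have "x \<in> span (S - {s})"
        using span_subset_iff_representation[OF S(1), of "S - {s}" x] x by (auto simp: f_def)
      moreover have "y = x + of_int k *\<^sub>R v" by (simp add: x_def)
      ultimately show "y \<in> {x + of_int k *\<^sub>R v | x k. x \<in> N \<inter> span (S - {s})}"
        using x by blast
    qed
  qed
  then show "\<exists>v. v \<in> N \<inter> convex_cone hull S \<and>
      N \<inter> span S = {x + of_int k *\<^sub>R v | x k. x \<in> N \<inter> span (S - {s})}"
    using vN v_cone by blast
qed

text \<open>\<open>normal_gen\<close> is a Hilbert choice, so its properties rest on the existence
  of an eligible vector.\<close>

lemma normal_gen: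
  fixes N :: "'a::euclidean_space set"
  assumes "is_lattice N" "independent S" "S \<subseteq> N" "s \<in> S"
  defines "v \<equiv> normal_gen N (convex_cone hull (S - {s})) (convex_cone hull S)"
  shows "v \<in> N" "v \<in> convex_cone hull S"
    "N \<inter> span S = {x + of_int k *\<^sub>R v | x k. x \<in> N \<inter> span (S - {s})}"
  using someI_ex[OF normal_gen_exists[OF assms(1-4)]]
  unfolding v_def normal_gen_def span_convex_cone_hull by auto

lemma primitive_gen:
  fixes N :: "'a::euclidean_space set"
  assumes N: "is_lattice N" and s: "s \<in> N" "s \<noteq> 0"
  defines "u \<equiv> primitive_gen N (convex_cone hull {s})"
  shows "u \<in> N" "\<exists>c>0. u = c *\<^sub>R s" "N \<inter> span {s} = {of_int k *\<^sub>R u | k. True}"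
proof -
  have S: "independent {s}" using s by simp
  \<comment> \<open>The cone \<open>{0}\<close> is the hull of the empty set, so a ray is the case
    of a one-element generating set.\<close>
  have u_def': "u = normal_gen N (convex_cone hull ({s} - {s})) (convex_cone hull {s})"
    by (simp add: u_def primitive_gen_def)
  have u: "u \<in> N" "u \<in> convex_cone hull {s}"
    and eq: "N \<inter> span {s} = {x + of_int k *\<^sub>R u | x k. x \<in> N \<inter> span ({s} - {s})}"
    using normal_gen[OF N S, of s] s unfolding u_def' by auto
  have "0 \<in> N" using lattice_add_scale[OF N s(1) s(1), of "-1"] by simp
  then show eq': "N \<inter> span {s} = {of_int k *\<^sub>R u | k. True}" using eq by auto
  have "s \<in> N \<inter> span {s}" using s by (simp add: span_base)
  then have "u \<noteq> 0" using eq' s by auto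
  then show "\<exists>c>0. u = c *\<^sub>R s"
    using u(2) unfolding convex_cone_hull_singleton by (auto simp: less_le)
  show "u \<in> N" by (rule u)
qed

section \<open>Simplicial fans\<close>

lemma fan_rational: "is_fan N \<Sigma> \<Longrightarrow> \<sigma> \<in> \<Sigma> \<Longrightarrow> rational_cone N \<sigma>"
  by (simp add: is_fan_def)

lemma fan_face: "is_fan N \<Sigma> \<Longrightarrow> \<sigma> \<in> \<Sigma> \<Longrightarrow> \<tau> face_of \<sigma> \<Longrightarrow> \<tau> \<noteq> {} \<Longrightarrow> \<tau> \<in> \<Sigma>"
  by (simp add: is_fan_def)

lemma fan_Int_face_of: "is_fan N \<Sigma> \<Longrightarrow> \<sigma> \<in> \<Sigma> \<Longrightarrow> \<tau> \<in> \<Sigma> \<Longrightarrow> (\<sigma> \<inter> \<tau>) face_of \<sigma>"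
  by (simp add: is_fan_def)

lemma fan_face_in:
  assumes "is_fan N \<Sigma>" "independent S" "convex_cone hull S \<in> \<Sigma>" "T \<subseteq> S"
  shows "convex_cone hull T \<in> \<Sigma>"
proof -
  have "(convex_cone hull T) face_of (convex_cone hull S)"
    by (rule convex_cone_hull_face_of) (use assms in auto)
  then show ?thesis
    by (rule fan_face[OF assms(1,3) _ convex_cone_hull_nonempty])
qed

text \<open>Simpliciality and rationality may be witnessed by different generating sets; on a ray, a
  nonzero lattice generator has to be a positive multiple of \<open>s\<close>.\<close>

lemma fan_ray_lattice_point:
  assumes fan: "is_fan N \<Sigma>" and ray: "convex_cone hull {s} \<in> \<Sigma>" and "s \<noteq> 0"
  obtains c where "c > 0" "c *\<^sub>R s \<in> N"
proof -
  obtain T where T: "T \<subseteq> N" "convex_cone hull {s} = convex_cone hull T"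
    using fan_rational[OF fan ray] unfolding rational_cone_def by metis
  have "\<not> T \<subseteq> {0}"
  proof
    assume "T \<subseteq> {0}"
    then have "convex_cone hull T \<subseteq> {0}" by (rule hull_minimal) simp
    moreover have "s \<in> convex_cone hull T" by (simp add: T(2)[symmetric] hull_inc)
    ultimately show False using \<open>s \<noteq> 0\<close> by blast
  qed
  then obtain t where t: "t \<in> T" "t \<noteq> 0" by blast
  then have "t \<in> convex_cone hull {s}" unfolding T(2) by (simp add: hull_inc)
  then obtain c where "0 \<le> c" "t = c *\<^sub>R s" unfolding convex_cone_hull_singleton by blast
  then show thesis using that[of c] t T(1) by (cases "c = 0") auto
qed

lemma ray_primitive_gen:
  fixes N :: "'a::euclidean_space set"
  assumes N: "is_lattice N" and fan: "is_fan N \<Sigma>" and ray: "convex_cone hull {s} \<in> \<Sigma>"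
    and s: "s \<noteq> 0"
  defines "u \<equiv> primitive_gen N (convex_cone hull {s})"
  shows "u \<in> N" "\<exists>c>0. u = c *\<^sub>R s" "convex_cone hull {u} = convex_cone hull {s}"
proof -
  obtain c where c: "c > 0" "c *\<^sub>R s \<in> N" using fan_ray_lattice_point[OF fan ray s] .
  have "c *\<^sub>R s \<noteq> 0" using c s by simp
  note u = primitive_gen[OF N c(2) this]
  have eq: "primitive_gen N (convex_cone hull {c *\<^sub>R s}) = u"
    by (simp add: u_def convex_cone_hull_singleton_scale[OF c(1)])
  show "u \<in> N" using u(1) eq by simp
  obtain c' where "c' > 0" "u = c' *\<^sub>R c *\<^sub>R s" using u(2) eq by auto
  then show "\<exists>c>0. u = c *\<^sub>R s" using c by (intro exI[of _ "c' * c"]) simp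
  then show "convex_cone hull {u} = convex_cone hull {s}"
    using convex_cone_hull_singleton_scale by metis
qed

lemma simplicial_rays:
  assumes "simplicial_fan N \<Sigma>"
  shows "\<rho> \<in> rays \<Sigma> \<longleftrightarrow> (\<exists>s. s \<noteq> 0 \<and> \<rho> = convex_cone hull {s} \<and> \<rho> \<in> \<Sigma>)"
proof
  assume \<rho>: "\<rho> \<in> rays \<Sigma>"
  then have "\<rho> \<in> \<Sigma>" "dim \<rho> = 1" by (auto simp: rays_def)
  moreover from this obtain S where "independent S" "\<rho> = convex_cone hull S"
    using assms unfolding simplicial_fan_def by blast
  moreover from calculation have "card S = 1" using dim_convex_cone_hull by metis
  ultimately show "\<exists>s. s \<noteq> 0 \<and> \<rho> = convex_cone hull {s} \<and> \<rho> \<in> \<Sigma>"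
    using dependent_zero by (auto simp: card_1_singleton_iff)
next
  assume "\<exists>s. s \<noteq> 0 \<and> \<rho> = convex_cone hull {s} \<and> \<rho> \<in> \<Sigma>"
  then show "\<rho> \<in> rays \<Sigma>"
    using dim_convex_cone_hull[of "{_}"] by (auto simp: rays_def)
qed

section \<open>From the fan to its sets of primitive generators\<close>

definition primitive_gens :: "'a::euclidean_space set \<Rightarrow> 'a set set \<Rightarrow> 'a set" where
  "primitive_gens N \<Sigma> = primitive_gen N ` rays \<Sigma>"

text \<open>This is the complex at which \<open>flat_link_fan\<close> is instantiated; primitive
  generators single out one vector on each ray.\<close>

definition cone_gens :: "'a::euclidean_space set \<Rightarrow> 'a set set \<Rightarrow> 'a set set" where
  "cone_gens N \<Sigma> = {S. S \<subseteq> primitive_gens N \<Sigma> \<and> independent S \<and> convex_cone hull S \<in> \<Sigma>}"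

context
  fixes N :: "'a::euclidean_space set" and \<Sigma> :: "'a set set"
  assumes N: "is_lattice N" and simplicial: "simplicial_fan N \<Sigma>"
begin

lemma is_fan_if_simplicial: "is_fan N \<Sigma>"
  using simplicial by (simp add: simplicial_fan_def)

lemma primitive_gens_iff:
  "u \<in> primitive_gens N \<Sigma> \<longleftrightarrow>
    u \<noteq> 0 \<and> convex_cone hull {u} \<in> \<Sigma> \<and> u = primitive_gen N (convex_cone hull {u})"
proof
  assume "u \<in> primitive_gens N \<Sigma>"
  then obtain \<rho> where \<rho>: "\<rho> \<in> rays \<Sigma>" and u: "u = primitive_gen N \<rho>"
    unfolding primitive_gens_def by (rule imageE)
  obtain s where s: "s \<noteq> 0" "\<rho> = convex_cone hull {s}" "convex_cone hull {s} \<in> \<Sigma>"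
    using \<rho> simplicial_rays[OF simplicial] by metis
  note gen = ray_primitive_gen[OF N is_fan_if_simplicial s(3,1), folded s(2) u]
  have "u \<noteq> 0" using gen(2) s(1) by auto
  then show "u \<noteq> 0 \<and> convex_cone hull {u} \<in> \<Sigma> \<and> u = primitive_gen N (convex_cone hull {u})"
    using gen(3) s(2,3) u by simp
next
  assume "u \<noteq> 0 \<and> convex_cone hull {u} \<in> \<Sigma> \<and> u = primitive_gen N (convex_cone hull {u})"
  moreover from this have "convex_cone hull {u} \<in> rays \<Sigma>"
    by (subst simplicial_rays[OF simplicial]) (intro exI[of _ u], simp)
  ultimately show "u \<in> primitive_gens N \<Sigma>"
    unfolding primitive_gens_def by (metis imageI)
qed

lemma primitive_gens_subset_lattice: "primitive_gens N \<Sigma> \<subseteq> N"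
  using primitive_gens_iff ray_primitive_gen(1)[OF N is_fan_if_simplicial] by (metis subsetI)

lemma primitive_gens_eq_if_ray_eq:
  assumes "u \<in> primitive_gens N \<Sigma>" "w \<in> primitive_gens N \<Sigma>"
    "convex_cone hull {u} = convex_cone hull {w}"
  shows "u = w"
  using assms primitive_gens_iff[of u] primitive_gens_iff[of w] by metis

text \<open>The generators provided by simpliciality are rescaled to primitive ones by positive
  factors, which preserves the cone.\<close>

lemma cone_gens_exists:
  assumes "\<sigma> \<in> \<Sigma>" shows "\<exists>S\<in>cone_gens N \<Sigma>. \<sigma> = convex_cone hull S"
proof -
  obtain S where S: "independent S" "\<sigma> = convex_cone hull S"
    using simplicial assms unfolding simplicial_fan_def by blast
  have ray: "convex_cone hull {s} \<in> \<Sigma>" "s \<noteq> 0" if "s \<in> S" for s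
    using fan_face_in[OF is_fan_if_simplicial S(1), of "{s}"] that assms S dependent_zero by auto
  have "\<exists>c>0. primitive_gen N (convex_cone hull {s}) = c *\<^sub>R s" if "s \<in> S" for s
    using ray_primitive_gen(2)[OF N is_fan_if_simplicial ray[OF that]] .
  then obtain c where c: "\<And>s. s \<in> S \<Longrightarrow> c s > 0"
    "\<And>s. s \<in> S \<Longrightarrow> primitive_gen N (convex_cone hull {s}) = c s *\<^sub>R s" by metis
  define T where "T = (\<lambda>s. c s *\<^sub>R s) ` S"
  have ne: "c s \<noteq> 0" if "s \<in> S" for s using c(1)[OF that] by simp
  have "convex_cone hull T = {x \<in> span S. \<forall>s\<in>S. 0 \<le> c s * representation S x s}"
    unfolding T_def by (rule convex_cone_hull_image_scale[OF S(1) ne])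
  also have "\<dots> = \<sigma>"
    unfolding S(2) convex_cone_hull_independent[OF S(1)] using c(1)
    by (auto simp: zero_le_mult_iff dest: less_imp_le) (meson less_le_not_le)+
  finally have "convex_cone hull T = \<sigma>" .
  moreover have "independent T"
    unfolding T_def by (rule independent_image_scale[OF S(1) ne])
  moreover have "T \<subseteq> primitive_gens N \<Sigma>"
  proof -
    have "c s *\<^sub>R s \<in> primitive_gens N \<Sigma>" if s: "s \<in> S" for s
      unfolding primitive_gens_def c(2)[OF s, symmetric]
      using simplicial_rays[OF simplicial] ray[OF s] by blast
    then show ?thesis by (auto simp: T_def)
  qed
  ultimately show ?thesis using assms by (auto simp: cone_gens_def)
qed

lemma image_cone_gens: "(hull) convex_cone ` cone_gens N \<Sigma> = \<Sigma>"
  using cone_gens_exists by (auto simp: cone_gens_def)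

lemma cone_gens_subset_closed:
  "S \<in> cone_gens N \<Sigma> \<Longrightarrow> T \<subseteq> S \<Longrightarrow> T \<in> cone_gens N \<Sigma>"
  using fan_face_in[OF is_fan_if_simplicial, of S T] independent_mono[of S T] by (auto simp: cone_gens_def)

lemma Union_cone_gens: "\<Union> (cone_gens N \<Sigma>) = primitive_gens N \<Sigma>"
proof
  show "primitive_gens N \<Sigma> \<subseteq> \<Union> (cone_gens N \<Sigma>)"
  proof
    fix u assume "u \<in> primitive_gens N \<Sigma>"
    then have "{u} \<in> cone_gens N \<Sigma>" using primitive_gens_iff by (auto simp: cone_gens_def)
    then show "u \<in> \<Union> (cone_gens N \<Sigma>)" by blast
  qed
qed (auto simp: cone_gens_def)

text \<open>The intersection of the two cones is a face of the first through \<open>x\<close>, so it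
  contains \<open>b\<close>. The ray of \<open>b\<close> then lies in the second cone and is a face
  of it, hence is generated by an element of \<open>T\<close>; primitivity identifies that element
  with \<open>b\<close>.\<close>

lemma cone_gens_compat:
  assumes S: "S \<in> cone_gens N \<Sigma>" and T: "T \<in> cone_gens N \<Sigma>"
    and x: "x \<in> convex_cone hull S" "x \<in> convex_cone hull T"
    and b: "representation S x b \<noteq> 0"
  shows "b \<in> T"
proof -
  have S': "independent S" "convex_cone hull S \<in> \<Sigma>"
    and T': "independent T" "convex_cone hull T \<in> \<Sigma>" using S T by (auto simp: cone_gens_def)
  have bU: "b \<in> primitive_gens N \<Sigma>"
    using representation_ne_zero[OF b] S by (auto simp: cone_gens_def)
  have "(convex_cone hull S \<inter> convex_cone hull T) face_of convex_cone hull S"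
    by (rule fan_Int_face_of[OF is_fan_if_simplicial S'(2) T'(2)])
  then have "b \<in> convex_cone hull S \<inter> convex_cone hull T"
    by (rule face_of_convex_cone_hull_support[OF S'(1)]) (use x b in auto)
  then have sub: "convex_cone hull {b} \<subseteq> convex_cone hull T"
    by (intro hull_minimal) (auto simp: convex_cone_convex_cone_hull)
  have "convex_cone hull {b} \<in> \<Sigma>" using bU primitive_gens_iff by simp
  then have "(convex_cone hull T \<inter> convex_cone hull {b}) face_of convex_cone hull T"
    by (rule fan_Int_face_of[OF is_fan_if_simplicial T'(2)])
  then have "(convex_cone hull {b}) face_of convex_cone hull T"
    using sub by (simp add: Int_absorb1)
  then have eq: "convex_cone hull {b} = convex_cone hull (T \<inter> convex_cone hull {b})"
    by (rule face_of_convex_cone_hull_eq[OF T'(1)]) (rule convex_cone_hull_nonempty)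
  have "T \<inter> convex_cone hull {b} \<noteq> {}"
  proof
    assume "T \<inter> convex_cone hull {b} = {}"
    then have "convex_cone hull {b} = {0}" using eq by simp
    moreover have "b \<in> convex_cone hull {b}" by (simp add: hull_inc)
    ultimately show False using bU primitive_gens_iff by auto
  qed
  then obtain t where t: "t \<in> T" "t \<in> convex_cone hull {b}" by blast
  have tU: "t \<in> primitive_gens N \<Sigma>" using t T by (auto simp: cone_gens_def)
  obtain c where c: "c \<ge> 0" "t = c *\<^sub>R b" using t(2) unfolding convex_cone_hull_singleton by blast
  moreover have "t \<noteq> 0" using tU primitive_gens_iff by blast
  ultimately have "convex_cone hull {t} = convex_cone hull {b}"
    using convex_cone_hull_singleton_scale[of c b] by (cases "c = 0") auto
  then show ?thesis using primitive_gens_eq_if_ray_eq[OF tU bU] t by blast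
qed

lemma finite_cone_gens: "finite (cone_gens N \<Sigma>)"
proof -
  have "finite \<Sigma>" using is_fan_if_simplicial by (simp add: is_fan_def)
  then have "finite (primitive_gens N \<Sigma>)" by (simp add: primitive_gens_def rays_def)
  then show ?thesis
    unfolding cone_gens_def by (rule finite_subset[rotated, OF finite_Pow_iff[THEN iffD2]]) blast
qed

text \<open>Subtracting from the local equation at \<open>\<rho>\<close> the character that trivialises the restriction
  gives a functional which agrees with all local equations around \<open>\<rho>\<close>.\<close>

lemma flat_link_functional:
  assumes u: "u \<in> primitive_gens N \<Sigma>"
    and zero: "restricts_to_zero N \<Sigma> (\<lambda>\<rho>'. - ray_divisor (convex_cone hull {u}) \<rho>')
      (convex_cone hull {u})"
  shows "\<exists>h. linear h \<and> h u = (1::real) \<and> (\<forall>w. u \<noteq> w \<longrightarrow> {u, w} \<in> cone_gens N \<Sigma> \<longrightarrow> h w = 0)"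
proof -
  define \<rho> where "\<rho> = convex_cone hull {u}"
  obtain m l where m: "cartier_data N \<Sigma> (\<lambda>\<rho>'. - ray_divisor \<rho> \<rho>') m"
    and l: "l \<in> MQ N" "\<forall>x\<in>\<rho>. l x = 0"
      "\<And>\<sigma>. \<sigma> \<in> prime_divisors \<Sigma> \<rho> \<Longrightarrow> restrict_divisor N \<rho> m \<sigma> - 0 = l (normal_gen N \<rho> \<sigma>)"
    using zero unfolding restricts_to_zero_def lin_equiv_def \<rho>_def[symmetric] by blast
  have ray: "convex_cone hull {w} \<in> rays \<Sigma>" "primitive_gen N (convex_cone hull {w}) = w"
    if "w \<in> primitive_gens N \<Sigma>" for w
    using that primitive_gens_iff simplicial_rays[OF simplicial] by metis+
  have lin_m: "linear (m \<sigma>)" if "\<sigma> \<in> \<Sigma>" for \<sigma>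
    using m that by (auto simp: cartier_data_def MQ_def)
  \<comment> \<open>The divisor is minus the ray divisor, and \<open>cartier_data\<close> negates
    once more, so the value at \<open>u\<close> is 1.\<close>
  have m_val: "m \<sigma> w = (if w = u then 1 else 0)"
    if \<sigma>: "\<sigma> \<in> \<Sigma>" "w \<in> \<sigma>" "convex_cone hull {w} \<subseteq> \<sigma>" "w \<in> primitive_gens N \<Sigma>" for \<sigma> w
  proof -
    have "m \<sigma> w = ray_divisor \<rho> (convex_cone hull {w})"
      using m ray[OF \<sigma>(4)] \<sigma> unfolding cartier_data_def by force
    moreover have "convex_cone hull {w} = \<rho> \<longleftrightarrow> w = u"
      using primitive_gens_eq_if_ray_eq[OF \<sigma>(4) u] by (auto simp: \<rho>_def)
    ultimately show ?thesis by (simp add: ray_divisor_def)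
  qed
  have \<rho>: "\<rho> \<in> \<Sigma>" "u \<in> \<rho>" using u primitive_gens_iff by (auto simp: \<rho>_def hull_inc)
  define h where "h x = m \<rho> x - l x" for x
  have lin_l: "linear l" using l(1) by (simp add: MQ_def)
  have lin_h: "linear h"
    unfolding h_def using lin_m[OF \<rho>(1)] lin_l by (rule linear_compose_sub)
  have hu: "h u = 1"
    using m_val[OF \<rho> _ u] l(2) \<rho>(2) by (simp add: h_def \<rho>_def)
  have "h w = 0" if ne: "u \<noteq> w" and K: "{u, w} \<in> cone_gens N \<Sigma>" for w
  proof -
    define \<sigma> where "\<sigma> = convex_cone hull {u, w}"
    have ind: "independent {u, w}" and \<sigma>: "\<sigma> \<in> \<Sigma>" and wU: "w \<in> primitive_gens N \<Sigma>"
      using K by (auto simp: cone_gens_def \<sigma>_def)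
    have in\<sigma>: "u \<in> \<sigma>" "w \<in> \<sigma>" "convex_cone hull {u} \<subseteq> \<sigma>" "convex_cone hull {w} \<subseteq> \<sigma>"
      unfolding \<sigma>_def by (auto intro: hull_inc hull_mono[THEN subsetD, rotated])
    have "\<rho> face_of \<sigma>"
      unfolding \<rho>_def \<sigma>_def by (rule convex_cone_hull_face_of[OF ind]) simp
    moreover have "dim \<sigma> = dim \<rho> + 1"
    proof -
      have "independent {u}" using ind by (rule independent_mono) simp
      then show ?thesis
        unfolding \<rho>_def \<sigma>_def dim_convex_cone_hull[OF ind] using ne
        by (simp add: dim_convex_cone_hull)
    qed
    ultimately have pd: "\<sigma> \<in> prime_divisors \<Sigma> \<rho>" using \<sigma> by (simp add: prime_divisors_def)
    define g where "g = normal_gen N \<rho> \<sigma>"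
    have "{u, w} - {w} = {u}" using ne by auto
    moreover have "{u, w} \<subseteq> N" using u wU primitive_gens_subset_lattice by auto
    ultimately have span_eq: "N \<inter> span {u, w} = {x + of_int k *\<^sub>R g | x k. x \<in> N \<inter> span {u}}"
      using normal_gen(3)[OF N ind, of w] by (simp add: g_def \<rho>_def \<sigma>_def)
    moreover have "w \<in> N \<inter> span {u, w}" using wU primitive_gens_subset_lattice by (auto simp: span_base)
    \<comment> \<open>The normal generator need not be \<open>w\<close>, but \<open>w\<close> is a
      combination of it and \<open>u\<close>; agreement of \<open>h\<close> with the local equation
      at these two vectors is enough.\<close>
    ultimately obtain x k where x: "x \<in> span {u}" and w: "w = x + of_int k *\<^sub>R g" by blast
    obtain a where a: "x = a *\<^sub>R u" using x by (auto simp: span_singleton)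
    have "m \<sigma> g = h g" using l(3)[OF pd] by (simp add: restrict_divisor_def g_def h_def)
    moreover have "m \<sigma> u = h u" using m_val[OF \<sigma> in\<sigma>(1,3) u] hu by simp
    ultimately have "h w = m \<sigma> w"
      unfolding w a using linear_add[OF lin_h] linear_cmul[OF lin_h]
        linear_add[OF lin_m[OF \<sigma>]] linear_cmul[OF lin_m[OF \<sigma>]] by simp
    then show ?thesis using m_val[OF \<sigma> in\<sigma>(2,4) wU] ne by simp
  qed
  then show ?thesis using lin_h hu by blast
qed

lemma cross_polytope_fan_if_restricts_to_zero:
  assumes complete: "complete_fan N \<Sigma>"
    and zero: "\<And>\<rho>. \<rho> \<in> rays \<Sigma> \<Longrightarrow> restricts_to_zero N \<Sigma> (\<lambda>\<rho>'. - ray_divisor \<rho> \<rho>') \<rho>"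
  shows "cross_polytope_fan (dim N) \<Sigma>"
proof -
  have "\<exists>h. linear h \<and> h u = (1::real) \<and> (\<forall>w. u \<noteq> w \<longrightarrow> {u, w} \<in> cone_gens N \<Sigma> \<longrightarrow> h w = 0)"
    if "u \<in> primitive_gens N \<Sigma>" for u
    using that primitive_gens_iff simplicial_rays[OF simplicial]
    by (intro flat_link_functional zero) metis+
  then obtain h where h: "\<And>u. u \<in> primitive_gens N \<Sigma> \<Longrightarrow> linear (h u)"
    "\<And>u. u \<in> primitive_gens N \<Sigma> \<Longrightarrow> h u u = (1::real)"
    "\<And>u w. u \<in> primitive_gens N \<Sigma> \<Longrightarrow> u \<noteq> w \<Longrightarrow> {u, w} \<in> cone_gens N \<Sigma> \<Longrightarrow> h u w = 0"
    by metis
  interpret flat_link_fan "cone_gens N \<Sigma>" "span N" h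
  proof (rule flat_link_fan.intro)
    show "(\<Union>S\<in>cone_gens N \<Sigma>. convex_cone hull S) = span N"
      using complete image_cone_gens unfolding complete_fan_def by simp
    show "h u w = 0" if "u \<noteq> w" "{u, w} \<in> cone_gens N \<Sigma>" for u w
      using h(3)[OF _ that] that(2) by (auto simp: cone_gens_def)
    show "independent S" if "S \<in> cone_gens N \<Sigma>" for S
      using that by (simp add: cone_gens_def)
  qed (use h(1,2) Union_cone_gens in \<open>simp_all del: Union_iff
        add: finite_cone_gens cone_gens_subset_closed cone_gens_compat\<close>)
  show ?thesis using cross_polytope_fan_cones by (simp add: image_cone_gens)
qed

end

section \<open>Products of projective lines\<close>

lemma strongly_convex_cone_hull_independent:
  fixes S :: "'a::euclidean_space set"
  assumes S: "independent S" shows "strongly_convex (convex_cone hull S)"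
proof -
  have "x = 0" if x: "x \<in> convex_cone hull S" "- x \<in> convex_cone hull S" for x
  proof -
    have xS: "x \<in> span S" using x(1) convex_cone_hull_subset_span by blast
    have "representation S x b = 0" if "b \<in> S" for b
      using x that by (auto simp: convex_cone_hull_independent[OF S] representation_neg[OF S xS] intro: antisym)
    then have "(\<Sum>b\<in>S. representation S x b *\<^sub>R b) = 0" by simp
    then show "x = 0" using sum_representation_eq[OF S xS finiteI_independent[OF S] order_refl] by simp
  qed
  moreover have "- 0 \<in> uminus ` (convex_cone hull S)"
    using convex_cone_hull_contains_0 by (rule imageI)
  ultimately show ?thesis
    unfolding strongly_convex_def using convex_cone_hull_contains_0[of S] by auto
qed

definition P1_cone :: "'a::euclidean_space set \<Rightarrow> ('a \<Rightarrow> real set) \<Rightarrow> 'a set" where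
  "P1_cone B c = {x \<in> span B. \<forall>b\<in>B. representation B x b \<in> c b}"

text \<open>Factors equal to \<open>{0}\<close> contribute no generator. For values in
  \<open>P1_fan\<close>, the \<open>else\<close> branch stands for \<open>{..0}\<close>.\<close>

definition P1_gens :: "'a::euclidean_space set \<Rightarrow> ('a \<Rightarrow> real set) \<Rightarrow> 'a set" where
  "P1_gens B c = (\<lambda>b. (if c b = {0..} then 1 else -1) *\<^sub>R b) ` {b \<in> B. c b \<noteq> {0}}"

lemma P1_power_fan_eq: "P1_power_fan B = {P1_cone B c | c. \<forall>b\<in>B. c b \<in> P1_fan}"
  unfolding P1_power_fan_def P1_cone_def ..

lemma atLeast_neq_singleton: "{0::real..} \<noteq> {0}" "{..0::real} \<noteq> {0}" "{..0::real} \<noteq> {0..}"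
proof -
  have "(1::real) \<in> {0..}" "(1::real) \<notin> {0}" "(-1::real) \<in> {..0}" "(-1::real) \<notin> {0}"
    "(-1::real) \<notin> {0..}" by auto
  then show "{0::real..} \<noteq> {0}" "{..0::real} \<noteq> {0}" "{..0::real} \<noteq> {0..}" by metis+
qed

lemma independent_P1_gens: "independent B \<Longrightarrow> independent (P1_gens B c)"
  unfolding P1_gens_def by (rule independent_image_scale) (erule independent_mono, auto)

text \<open>The factors \<open>{0}\<close> cut the span down to that of the remaining basis vectors,
  where the other factors become sign conditions.\<close>

lemma P1_cone_eq_hull:
  fixes B :: "'a::euclidean_space set"
  assumes B: "independent B" and c: "\<forall>b\<in>B. c b \<in> P1_fan"
  shows "P1_cone B c = convex_cone hull (P1_gens B c)"
proof -
  define B' where "B' = {b \<in> B. c b \<noteq> {0}}"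
  have sub: "B' \<subseteq> B" by (auto simp: B'_def)
  have B': "independent B'" using B sub by (rule independent_mono)
  define s where "s b = (if c b = {0..} then 1 else -1 :: real)" for b
  have hull: "convex_cone hull (P1_gens B c) = {x \<in> span B'. \<forall>b\<in>B'. 0 \<le> s b * representation B' x b}"
    unfolding P1_gens_def s_def[symmetric] B'_def[symmetric]
    by (rule convex_cone_hull_image_scale[OF B']) (simp add: s_def)
  have mem: "t \<in> c b \<longleftrightarrow> 0 \<le> s b * t" if "b \<in> B'" for b t
    using c that by (auto simp: B'_def P1_fan_def s_def atLeast_neq_singleton)
  have rep: "representation B x = representation B' x" if "x \<in> span B'" for x
    using B that sub by (rule representation_extend)
  have span: "x \<in> span B' \<longleftrightarrow> x \<in> span B \<and> (\<forall>b\<in>B - B'. representation B x b \<in> c b)" for x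
  proof -
    have "c b = {0}" if "b \<in> B - B'" for b using that by (auto simp: B'_def)
    then show ?thesis
      using span_subset_iff_representation[OF B sub, of x] span_mono[OF sub] by auto
  qed
  have "P1_cone B c = {x \<in> span B'. \<forall>b\<in>B'. representation B x b \<in> c b}"
    unfolding P1_cone_def using span sub by blast
  also have "\<dots> = {x \<in> span B'. \<forall>b\<in>B'. 0 \<le> s b * representation B' x b}"
    using mem rep by auto
  finally show ?thesis using hull by simp
qed

lemma P1_cone_Int: "P1_cone B c \<inter> P1_cone B c' = P1_cone B (\<lambda>b. c b \<inter> c' b)"
  by (auto simp: P1_cone_def)

lemma P1_fan_Int: "C \<in> P1_fan \<Longrightarrow> C' \<in> P1_fan \<Longrightarrow> C \<inter> C' = C \<or> C \<inter> C' = {0}"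
  by (auto simp: P1_fan_def)

text \<open>Intersecting factor by factor either keeps a factor of the first cone or collapses it to
  \<open>{0}\<close>, so the intersection is generated by a subset of the generators of the first
  cone.\<close>

lemma P1_cone_Int_face_of:
  fixes B :: "'a::euclidean_space set"
  assumes B: "independent B" and c: "\<forall>b\<in>B. c b \<in> P1_fan"
    and c': "\<forall>b\<in>B. c' b \<in> P1_fan"
  shows "(P1_cone B c \<inter> P1_cone B c') face_of P1_cone B c"
proof -
  have Int: "c b \<inter> c' b = c b \<or> c b \<inter> c' b = {0}" if "b \<in> B" for b
    using P1_fan_Int c c' that by blast
  have "\<forall>b\<in>B. c b \<inter> c' b \<in> P1_fan"
    using Int c by (metis insertI1 P1_fan_def)
  then have "P1_cone B c \<inter> P1_cone B c' = convex_cone hull (P1_gens B (\<lambda>b. c b \<inter> c' b))"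
    unfolding P1_cone_Int by (rule P1_cone_eq_hull[OF B])
  moreover have "P1_gens B (\<lambda>b. c b \<inter> c' b) \<subseteq> P1_gens B c"
  proof
    fix x assume "x \<in> P1_gens B (\<lambda>b. c b \<inter> c' b)"
    then obtain b where b: "b \<in> B" "c b \<inter> c' b \<noteq> {0}"
      and x: "x = (if c b \<inter> c' b = {0..} then 1 else -1) *\<^sub>R b" by (auto simp: P1_gens_def)
    then have "c b \<inter> c' b = c b" using Int by blast
    then show "x \<in> P1_gens B c" using b x by (auto simp: P1_gens_def)
  qed
  ultimately show ?thesis
    using convex_cone_hull_face_of[OF independent_P1_gens[OF B]] P1_cone_eq_hull[OF B c] by metis
qed

lemma P1_cone_face:
  fixes B :: "'a::euclidean_space set"
  assumes B: "independent B" and c: "\<forall>b\<in>B. c b \<in> P1_fan"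
    and F: "F face_of P1_cone B c" "F \<noteq> {}"
  obtains c' where "\<forall>b\<in>B. c' b \<in> P1_fan" "F = P1_cone B c'"
proof -
  define s where "s b = (if c b = {0..} then 1 else -1 :: real)" for b
  \<comment> \<open>Collapse the factors whose generator is not in the face.\<close>
  define c' where "c' b = (if s b *\<^sub>R b \<in> F then c b else {0})" for b
  have c': "\<forall>b\<in>B. c' b \<in> P1_fan"
    using c by (auto simp: c'_def P1_fan_def)
  have "F = convex_cone hull (P1_gens B c \<inter> F)"
    by (rule face_of_convex_cone_hull_eq[OF independent_P1_gens[OF B]])
       (use F in \<open>simp_all add: P1_cone_eq_hull[OF B c]\<close>)
  also have "P1_gens B c \<inter> F = (\<lambda>b. s b *\<^sub>R b) ` {b \<in> B. c b \<noteq> {0} \<and> s b *\<^sub>R b \<in> F}"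
    unfolding P1_gens_def s_def by blast
  also have "\<dots> = P1_gens B c'"
    unfolding P1_gens_def
    by (rule image_cong) (auto simp: c'_def s_def atLeast_neq_singleton split: if_splits)
  also have "convex_cone hull (P1_gens B c') = P1_cone B c'"
    using P1_cone_eq_hull[OF B c'] by simp
  finally show thesis using that c' by blast
qed

section \<open>Fan axioms and ray divisors for the product of projective lines\<close>

context
  fixes N B :: "'a::euclidean_space set"
  assumes basis: "lattice_basis N B"
begin

lemma indep_B: "independent B" and finite_B: "finite B"
  using basis by (auto simp: lattice_basis_def)

lemma lattice_N: "is_lattice N"
  using basis by (auto simp: is_lattice_def)

lemmas N_eq = lattice_basis_representation[OF basis]

lemma basis_scale_in_lattice:
  assumes "b \<in> B" shows "c *\<^sub>R b \<in> N \<longleftrightarrow> c \<in> \<int>"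
proof -
  have "representation B (c *\<^sub>R b) a = (if a = b then c else 0)" for a
    using assms by (simp add: indep_B representation_scale span_base representation_basis)
  then show ?thesis
    using assms by (subst N_eq) (auto simp: span_base span_scale)
qed

lemma span_lattice: "span N = span B"
proof
  have "B \<subseteq> N" using basis_scale_in_lattice[of _ 1] by auto
  then show "span B \<subseteq> span N" by (rule span_mono)
  have "N \<subseteq> span B" using N_eq by blast
  then show "span N \<subseteq> span B" by (rule span_minimal) simp
qed

lemma P1_gens_subset_lattice: "P1_gens B c \<subseteq> N"
proof -
  have "(if c b = {0..} then 1 else -1 :: real) \<in> \<int>" for b by simp
  then show ?thesis unfolding P1_gens_def using basis_scale_in_lattice by blast
qed

lemma P1_power_fanE:
  assumes "\<sigma> \<in> P1_power_fan B"
  obtains c where "\<forall>b\<in>B. c b \<in> P1_fan" "\<sigma> = P1_cone B c" "\<sigma> = convex_cone hull (P1_gens B c)"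
proof -
  obtain c where c: "\<forall>b\<in>B. c b \<in> P1_fan" "\<sigma> = P1_cone B c"
    using assms unfolding P1_power_fan_eq by blast
  show thesis by (rule that[OF c]) (simp add: c(2) P1_cone_eq_hull[OF indep_B c(1)])
qed

lemma is_fan_P1_power_fan: "is_fan N (P1_power_fan B)"
  unfolding is_fan_def
proof (intro conjI ballI allI impI)
  have "P1_power_fan B \<subseteq> P1_cone B ` PiE B (\<lambda>_. P1_fan)"
  proof
    fix \<sigma> assume "\<sigma> \<in> P1_power_fan B"
    then obtain c where c: "\<forall>b\<in>B. c b \<in> P1_fan" "\<sigma> = P1_cone B c"
      using P1_power_fanE by metis
    \<comment> \<open>Values of \<open>c\<close> off \<open>B\<close> do not affect the cone; fixing
      them leaves finitely many choices.\<close>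
    then have "restrict c B \<in> PiE B (\<lambda>_. P1_fan)" "\<sigma> = P1_cone B (restrict c B)"
      by (auto simp: P1_cone_def)
    then show "\<sigma> \<in> P1_cone B ` PiE B (\<lambda>_. P1_fan)" by blast
  qed
  moreover have "finite (PiE B (\<lambda>_. P1_fan))"
    using finite_B by (intro finite_PiE) (auto simp: P1_fan_def)
  ultimately show "finite (P1_power_fan B)" by (meson finite_imageI finite_subset)
  show "P1_power_fan B \<noteq> {}"
    unfolding P1_power_fan_eq by (auto simp: P1_fan_def)
next
  fix \<sigma> assume "\<sigma> \<in> P1_power_fan B"
  then obtain c where \<sigma>: "\<sigma> = convex_cone hull (P1_gens B c)" using P1_power_fanE by metis
  show "rational_cone N \<sigma>"
    unfolding rational_cone_def \<sigma>
    using P1_gens_subset_lattice finiteI_independent[OF independent_P1_gens[OF indep_B]] by blast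
  show "strongly_convex \<sigma>"
    unfolding \<sigma> by (rule strongly_convex_cone_hull_independent[OF independent_P1_gens[OF indep_B]])
next
  fix \<sigma> \<tau> assume \<sigma>: "\<sigma> \<in> P1_power_fan B" and \<tau>: "\<tau> face_of \<sigma> \<and> \<tau> \<noteq> {}"
  obtain c where c: "\<forall>b\<in>B. c b \<in> P1_fan" "\<sigma> = P1_cone B c"
    using P1_power_fanE[OF \<sigma>] by metis
  obtain c' where "\<forall>b\<in>B. c' b \<in> P1_fan" "\<tau> = P1_cone B c'"
    using P1_cone_face[OF indep_B c(1)] \<tau> c(2) by metis
  then show "\<tau> \<in> P1_power_fan B" unfolding P1_power_fan_eq by blast
next
  fix \<sigma> \<tau> assume \<sigma>: "\<sigma> \<in> P1_power_fan B" and \<tau>: "\<tau> \<in> P1_power_fan B"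
  obtain c where c: "\<forall>b\<in>B. c b \<in> P1_fan" "\<sigma> = P1_cone B c"
    using P1_power_fanE[OF \<sigma>] by metis
  obtain c' where c': "\<forall>b\<in>B. c' b \<in> P1_fan" "\<tau> = P1_cone B c'"
    using P1_power_fanE[OF \<tau>] by metis
  show "(\<sigma> \<inter> \<tau>) face_of \<sigma>"
    unfolding c(2) c'(2) by (rule P1_cone_Int_face_of[OF indep_B c(1) c'(1)])
  show "(\<sigma> \<inter> \<tau>) face_of \<tau>"
    unfolding c(2) c'(2) Int_commute[of "P1_cone B c"]
    by (rule P1_cone_Int_face_of[OF indep_B c'(1) c(1)])
qed

lemma complete_fan_P1_power_fan: "complete_fan N (P1_power_fan B)"
  unfolding complete_fan_def span_lattice
proof (intro conjI is_fan_P1_power_fan equalityI subsetI)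
  fix x assume x: "x \<in> span B"
  define c where "c b = (if 0 \<le> representation B x b then {0..} else {..0::real})" for b
  have "x \<in> P1_cone B c" using x by (auto simp: P1_cone_def c_def)
  moreover have "\<forall>b\<in>B. c b \<in> P1_fan" by (simp add: c_def P1_fan_def)
  then have "P1_cone B c \<in> P1_power_fan B" unfolding P1_power_fan_eq by blast
  ultimately show "x \<in> \<Union> (P1_power_fan B)" by blast
qed (auto simp: P1_power_fan_eq P1_cone_def)

lemma simplicial_fan_P1_power_fan: "simplicial_fan N (P1_power_fan B)"
  unfolding simplicial_fan_def
proof (intro conjI is_fan_P1_power_fan ballI)
  fix \<sigma> assume "\<sigma> \<in> P1_power_fan B"
  then obtain c where "\<sigma> = convex_cone hull (P1_gens B c)" using P1_power_fanE by metis
  then show "\<exists>S. finite S \<and> independent S \<and> \<sigma> = convex_cone hull S"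
    using independent_P1_gens[OF indep_B] finiteI_independent by metis
qed

text \<open>Write the primitive generator as \<open>k *\<^sub>R u\<close> with \<open>u\<close> a
  signed basis vector. Integrality makes \<open>k\<close> an integer, and \<open>u\<close> is in
  turn an integral multiple of the generator, so the positive \<open>k\<close> is 1.\<close>

lemma P1_power_fan_ray:
  assumes \<rho>: "\<rho> \<in> rays (P1_power_fan B)"
  obtains b e where "b \<in> B" "e \<in> {1, -1::real}" "\<rho> = convex_cone hull {e *\<^sub>R b}"
    "primitive_gen N \<rho> = e *\<^sub>R b"
proof -
  have "\<rho> \<in> P1_power_fan B" "dim \<rho> = 1" using \<rho> by (auto simp: rays_def)
  then obtain c where "\<rho> = convex_cone hull (P1_gens B c)" "card (P1_gens B c) = 1"
    by (metis P1_power_fanE dim_convex_cone_hull independent_P1_gens indep_B)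
  then obtain u where u: "P1_gens B c = {u}" "\<rho> = convex_cone hull {u}"
    by (auto simp: card_1_singleton_iff)
  then have "u \<in> P1_gens B c" by simp
  then obtain b where b: "b \<in> B" and ub: "u = (if c b = {0..} then 1 else -1) *\<^sub>R b"
    unfolding P1_gens_def by blast
  define e where "e = (if c b = {0..} then 1 else -1 :: real)"
  have e: "e \<in> {1, -1}" by (simp add: e_def)
  have ub: "u = e *\<^sub>R b" using ub by (simp add: e_def)
  have "b \<noteq> 0" using b indep_B dependent_zero by blast
  then have u0: "u \<noteq> 0" using ub e by auto
  have uN: "u \<in> N" using ub e b basis_scale_in_lattice by auto
  note gen = primitive_gen[OF lattice_N uN u0, folded u(2)]
  obtain k where k: "k > 0" "primitive_gen N \<rho> = k *\<^sub>R u" using gen(2) by blast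
  have "k * e \<in> \<int>" using gen(1) basis_scale_in_lattice[OF b, of "k * e"] k(2) ub by simp
  then have "k \<in> \<int>" using e by auto
  moreover have "u \<in> N \<inter> span {u}" using uN by (simp add: span_base)
  then obtain j :: int where "u = of_int j *\<^sub>R primitive_gen N \<rho>" using gen(3) by auto
  then have "1 *\<^sub>R u = (of_int j * k) *\<^sub>R u" using k(2) by simp
  then have "of_int j * k = 1" using u0 by (metis scaleR_cancel_right)
  ultimately have "k = 1"
    using k(1) by (auto elim!: Ints_cases simp flip: of_int_mult simp: zmult_eq_1_iff)
  then show thesis using that[OF b e] u(2) ub k(2) by simp
qed

lemma P1_power_fan_restricts_to_zero:
  assumes \<rho>: "\<rho> \<in> rays (P1_power_fan B)"
  shows "restricts_to_zero N (P1_power_fan B) (\<lambda>\<rho>'. - ray_divisor \<rho> \<rho>') \<rho>"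
proof -
  obtain b e where b: "b \<in> B" and e: "e \<in> {1, -1::real}" and \<rho>_eq: "\<rho> = convex_cone hull {e *\<^sub>R b}"
    and prim: "primitive_gen N \<rho> = e *\<^sub>R b"
    using P1_power_fan_ray[OF \<rho>] .
  obtain g :: "'a \<Rightarrow> real" where g: "linear g" "\<And>x. x \<in> span B \<Longrightarrow> g x = representation B x b"
    using coordinate_functional[OF indep_B b] by blast
  have g_basis: "g (t *\<^sub>R a) = (if a = b then t else 0)" if "a \<in> B" for a t
    using that by (simp add: linear_cmul[OF g(1)] g(2) span_base representation_basis indep_B)
  \<comment> \<open>The signed coordinate at \<open>b\<close> is a local equation on every cone
    containing \<rho>, and zero serves on all other cones. Near \<rho> the data thus coincide, and
    the zero character trivialises the restriction.\<close>
  define m where "m \<sigma> x = (if \<rho> \<subseteq> \<sigma> then e * g x else 0)" for \<sigma> x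
  have "m \<sigma> \<in> MQ N" for \<sigma>
  proof -
    have "linear (m \<sigma>)"
      using linear_compose_scale_right[OF g(1), of e]
      by (cases "\<rho> \<subseteq> \<sigma>") (simp_all add: m_def[abs_def] linear_zero)
    moreover have "m \<sigma> x \<in> \<rat>" if "x \<in> N" for x
    proof -
      have "x \<in> span B" "representation B x b \<in> \<int>" using that b N_eq by blast+
      then have "g x \<in> \<rat>" using g(2) Ints_subset_Rats by auto
      then show ?thesis using e by (auto simp: m_def)
    qed
    ultimately show ?thesis by (simp add: MQ_def)
  qed
  moreover have "m \<sigma> (primitive_gen N \<rho>') = ray_divisor \<rho> \<rho>'"
    if \<sigma>: "\<sigma> \<in> P1_power_fan B" and \<rho>': "\<rho>' \<in> rays (P1_power_fan B)" "\<rho>' \<subseteq> \<sigma>" for \<sigma> \<rho>'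
  proof (cases "\<rho>' = \<rho>")
    case True
    then show ?thesis using \<rho>' e b by (auto simp: m_def prim g_basis ray_divisor_def simp del: scaleR_minus1_left)
  next
    case False
    obtain b' e' where b': "b' \<in> B" and e': "e' \<in> {1, -1::real}"
      and \<rho>'_eq: "\<rho>' = convex_cone hull {e' *\<^sub>R b'}" and prim': "primitive_gen N \<rho>' = e' *\<^sub>R b'"
      using P1_power_fan_ray[OF \<rho>'(1)] .
    \<comment> \<open>A different ray over the same basis vector would be the opposite of \<rho>,
      and a strongly convex cone cannot contain both.\<close>
    have "b' \<noteq> b" if sub: "\<rho> \<subseteq> \<sigma>"
    proof
      assume "b' = b"
      then have "e' = - e" using False e e' by (auto simp: \<rho>_eq \<rho>'_eq)
      moreover have "e *\<^sub>R b \<in> \<sigma>" "e' *\<^sub>R b' \<in> \<sigma>"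
        using sub \<rho>'(2) unfolding \<rho>_eq \<rho>'_eq by (auto intro: hull_inc)
      ultimately have "e *\<^sub>R b \<in> \<sigma> \<inter> uminus ` \<sigma>"
        using \<open>b' = b\<close> by (auto intro!: image_eqI[of _ uminus "e' *\<^sub>R b'"])
      moreover have "strongly_convex \<sigma>"
        using is_fan_P1_power_fan \<sigma> by (simp add: is_fan_def)
      ultimately have "e *\<^sub>R b = 0" unfolding strongly_convex_def by blast
      then show False using b e indep_B dependent_zero by auto
    qed
    then show ?thesis using False b' by (simp add: m_def prim' g_basis ray_divisor_def)
  qed
  ultimately have "cartier_data N (P1_power_fan B) (\<lambda>\<rho>'. - ray_divisor \<rho> \<rho>') m"
    by (simp add: cartier_data_def)
  moreover have "m \<sigma> = m \<rho>" if "\<sigma> \<in> prime_divisors (P1_power_fan B) \<rho>" for \<sigma>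
    using that by (auto simp: prime_divisors_def face_of_def m_def)
  then have "lin_equiv N (P1_power_fan B) \<rho> (restrict_divisor N \<rho> m) (\<lambda>_. 0)"
    unfolding lin_equiv_def restrict_divisor_def
    by (intro bexI[of _ "\<lambda>_. 0"]) (auto simp: MQ_def linear_zero)
  ultimately show ?thesis unfolding restricts_to_zero_def by blast
qed

end

theorem proposition1p13:
  fixes N :: "'a::euclidean_space set" and d :: nat
  assumes "is_lattice N" and "dim N = d"
  shows "(\<forall>\<Sigma>. complete_fan N \<Sigma> \<and> simplicial_fan N \<Sigma> \<and>
              (\<forall>\<rho>\<in>rays \<Sigma>. restricts_to_zero N \<Sigma> (\<lambda>\<rho>'. - ray_divisor \<rho> \<rho>') \<rho>)
            \<longrightarrow> cross_polytope_fan d \<Sigma>)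
       \<and> (\<forall>B. lattice_basis N B \<longrightarrow>
              complete_fan N (P1_power_fan B) \<and> simplicial_fan N (P1_power_fan B) \<and>
              cross_polytope_fan d (P1_power_fan B) \<and>
              (\<forall>\<rho>\<in>rays (P1_power_fan B).
                 restricts_to_zero N (P1_power_fan B) (\<lambda>\<rho>'. - ray_divisor \<rho> \<rho>') \<rho>))"
proof (intro conjI allI impI ballI)
  fix \<Sigma>
  assume \<Sigma>: "complete_fan N \<Sigma> \<and> simplicial_fan N \<Sigma> \<and>
    (\<forall>\<rho>\<in>rays \<Sigma>. restricts_to_zero N \<Sigma> (\<lambda>\<rho>'. - ray_divisor \<rho> \<rho>') \<rho>)"
  show "cross_polytope_fan d \<Sigma>"
    unfolding assms(2)[symmetric]
    by (rule cross_polytope_fan_if_restricts_to_zero[OF assms(1)]) (simp_all add: \<Sigma>)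
next
  fix B assume B: "lattice_basis N B"
  show "complete_fan N (P1_power_fan B)" by (rule complete_fan_P1_power_fan[OF B])
  show "simplicial_fan N (P1_power_fan B)" by (rule simplicial_fan_P1_power_fan[OF B])
  show "restricts_to_zero N (P1_power_fan B) (\<lambda>\<rho>'. - ray_divisor \<rho> \<rho>') \<rho>"
    if "\<rho> \<in> rays (P1_power_fan B)" for \<rho>
    by (rule P1_power_fan_restricts_to_zero[OF B that])
  \<comment> \<open>The shape of the product fan is not computed by hand: the vanishing of its
    restrictions places it under the first implication.\<close>
  then show "cross_polytope_fan d (P1_power_fan B)"
    unfolding assms(2)[symmetric]
    by (rule cross_polytope_fan_if_restricts_to_zero[OF assms(1) simplicial_fan_P1_power_fan[OF B]
          complete_fan_P1_power_fan[OF B]])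
qed

end
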